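(* Let $k$ be a commutative Noetherian ring and $m\geq 1$. The category $\mathscr{C}$ (the skeleton of $\mathrm{FI}^m$) is locally Noetherian over $k$; that is, every submodule of a finitely generated $\mathscr{C}$-module (over $k$) is finitely generated.
   Context: Let $m\geq 1$ be an integer and $\mathbb{N}$ the set of nonnegative integers; write $[n]=\{1,\ldots,n\}$, $[0]=\emptyset$. The category $\mathrm{FI}^m$ has as objects $m$-tuples of finite sets and as morphisms $m$-tuples of injections. Its skeletal full subcategory $\mathscr{C}$ has objects $\mathbf{n}=(n_1,\ldots,n_m)\in\mathbb{N}^m$ (standing for $([n_1],\ldots,[n_m])$); a morphism $\mathbf{f}:\mathbf{n}\to\mathbf{t}$ is a tuple $(f_1,\ldots,f_m)$ of injections $f_i:[n_i]\to[t_i]$, composed componentwise. A $\mathscr{C}$-module is a covariant functor $V$ from $\mathscr{C}$ to the category of $k$-modules; its value on $\mathbf{n}$ is written $V_{\mathbf{n}}$. $M(\mathbf{n})$ denotes the $\mathscr{C}$-module obtained as the $k$-linearization of the representable functor $\mathscr{C}(\mathbf{n},-)$. $V$ is finitely generated if there is a surjection $\bigoplus_{\mathbf{n}\in\mathbb{N}^m} M(\mathbf{n})^{\oplus a_{\mathbf{n}}}\to V$ with $\sum_{\mathbf{n}} a_{\mathbf{n}}<\infty$. *)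

theory Defs
  imports "HOL-Algebra.Module" "HOL-Algebra.Ring_Divisibility" "HOL-Library.FuncSet"
begin

section \<open>Categories\<close>

text \<open>An arrow alone need not determine its source and target (an injection into \<open>[t]\<close> is also one
  into \<open>[t + 1]\<close>), so operations on arrows take the objects involved as arguments:
  \<open>cmp C x y z g f\<close> is the composite of \<open>f : x \<rightarrow> y\<close> followed by \<open>g : y \<rightarrow> z\<close>.\<close>

record ('o, 'a) cat =
  obs :: "'o set"
  homs :: "'o \<Rightarrow> 'o \<Rightarrow> 'a set"
  ident :: "'o \<Rightarrow> 'a"
  cmp :: "'o \<Rightarrow> 'o \<Rightarrow> 'o \<Rightarrow> 'a \<Rightarrow> 'a \<Rightarrow> 'a"

locale category =
  fixes C :: "('o, 'a) cat" (structure)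
  assumes ident_closed: "x \<in> obs C \<Longrightarrow> ident C x \<in> homs C x x"
    and cmp_closed: "\<lbrakk>x \<in> obs C; y \<in> obs C; z \<in> obs C; f \<in> homs C x y; g \<in> homs C y z\<rbrakk>
      \<Longrightarrow> cmp C x y z g f \<in> homs C x z"
    and cmp_ident_right: "\<lbrakk>x \<in> obs C; y \<in> obs C; f \<in> homs C x y\<rbrakk>
      \<Longrightarrow> cmp C x x y f (ident C x) = f"
    and cmp_ident_left: "\<lbrakk>x \<in> obs C; y \<in> obs C; f \<in> homs C x y\<rbrakk>
      \<Longrightarrow> cmp C x y y (ident C y) f = f"
    and cmp_assoc: "\<lbrakk>w \<in> obs C; x \<in> obs C; y \<in> obs C; z \<in> obs C;
        f \<in> homs C w x; g \<in> homs C x y; h \<in> homs C y z\<rbrakk>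
      \<Longrightarrow> cmp C w y z h (cmp C w x y g f) = cmp C w x z (cmp C x y z h g) f"

text \<open>The skeleton of \<open>FI\<^sup>m\<close>. Objects are extensional functions on \<open>{1..m}\<close>, i.e. the points of
  \<open>\<nat>\<^sup>m\<close>; arrows are extensional in the index and in the argument, so that equality of arrows is
  equality of tuples of injections.\<close>

definition FI_pow :: "nat \<Rightarrow> (nat \<Rightarrow> nat, nat \<Rightarrow> nat \<Rightarrow> nat) cat" where
  "FI_pow m = \<lparr>
     obs = {1..m} \<rightarrow>\<^sub>E (UNIV :: nat set),
     homs = (\<lambda>n t. \<Pi>\<^sub>E i\<in>{1..m}. {f \<in> {1..n i} \<rightarrow>\<^sub>E {1..t i}. inj_on f {1..n i}}),
     ident = (\<lambda>n. \<lambda>i\<in>{1..m}. \<lambda>a\<in>{1..n i}. a),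
     cmp = (\<lambda>n t u g f. \<lambda>i\<in>{1..m}. compose {1..n i} (g i) (f i))\<rparr>"

lemma category_FI_pow: "category (FI_pow m)"
proof
  fix w x y z f g h
  { assume "x \<in> obs (FI_pow m)"
    show "ident (FI_pow m) x \<in> homs (FI_pow m) x x"
      by (auto simp: FI_pow_def intro!: inj_onI) }
  { assume f: "f \<in> homs (FI_pow m) x y"
    show "cmp (FI_pow m) x x y f (ident (FI_pow m) x) = f"
      using f by (auto simp: FI_pow_def compose_def PiE_iff extensional_def fun_eq_iff)
    have maps: "f i a \<in> {1..y i}" if "i \<in> {1..m}" "a \<in> {1..x i}" for i a
      using f that unfolding FI_pow_def by (simp add: PiE_iff)
    show "cmp (FI_pow m) x y y (ident (FI_pow m) y) f = f"
      using f maps by (auto simp: FI_pow_def compose_def PiE_iff extensional_def fun_eq_iff)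
    assume g: "g \<in> homs (FI_pow m) y z"
    have "compose {1..x i} (g i) (f i) \<in> {1..x i} \<rightarrow>\<^sub>E {1..z i}
        \<and> inj_on (compose {1..x i} (g i) (f i)) {1..x i}" if i: "i \<in> {1..m}" for i
    proof -
      have fi: "f i \<in> {1..x i} \<rightarrow>\<^sub>E {1..y i}" "inj_on (f i) {1..x i}"
        and gi: "g i \<in> {1..y i} \<rightarrow>\<^sub>E {1..z i}" "inj_on (g i) {1..y i}"
        using f g i by (simp_all add: FI_pow_def PiE_iff)
      have sub: "f i ` {1..x i} \<subseteq> {1..y i}"
        using fi(1) by (simp add: PiE_iff image_subset_iff)
      have "inj_on (g i \<circ> f i) {1..x i}"
        by (rule comp_inj_on[OF fi(2) inj_on_subset[OF gi(2) sub]])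
      then have "inj_on (compose {1..x i} (g i) (f i)) {1..x i}"
        unfolding compose_def inj_on_restrict_eq comp_def .
      moreover have "compose {1..x i} (g i) (f i) \<in> {1..x i} \<rightarrow>\<^sub>E {1..z i}"
        using fi(1) gi(1) unfolding compose_def PiE_iff by simp
      ultimately show ?thesis by blast
    qed
    then show "cmp (FI_pow m) x y z g f \<in> homs (FI_pow m) x z"
      by (simp add: FI_pow_def restrict_PiE_iff) }
  { assume f: "f \<in> homs (FI_pow m) w x"
    have maps: "f i a \<in> {1..x i}" if "i \<in> {1..m}" "a \<in> {1..w i}" for i a
      using f that unfolding FI_pow_def by (simp add: PiE_iff)
    then show "cmp (FI_pow m) w y z h (cmp (FI_pow m) w x y g f)
        = cmp (FI_pow m) w x z (cmp (FI_pow m) x y z h g) f"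
      by (simp add: FI_pow_def compose_def fun_eq_iff) }
qed

section \<open>Modules over a ring\<close>

text \<open>A \<^typ>\<open>('r, 'v) module\<close> record extends a ring record; its multiplicative fields
  play no role for modules and are left unspecified below.\<close>

definition module_hom ::
  "('r, 'x) ring_scheme \<Rightarrow> ('r, 'v) module \<Rightarrow> ('r, 'w) module \<Rightarrow> ('v \<Rightarrow> 'w) set" where
  "module_hom R M N = {h \<in> hom (add_monoid M) (add_monoid N).
     \<forall>a\<in>carrier R. \<forall>v\<in>carrier M. h (a \<odot>\<^bsub>M\<^esub> v) = a \<odot>\<^bsub>N\<^esub> h v}"

definition free_module :: "('r, 'x) ring_scheme \<Rightarrow> 's set \<Rightarrow> ('r, 's \<Rightarrow> 'r) module" where
  "free_module R S = \<lparr>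
     carrier = {c \<in> S \<rightarrow>\<^sub>E carrier R. finite {s \<in> S. c s \<noteq> \<zero>\<^bsub>R\<^esub>}},
     monoid.mult = undefined, one = undefined,
     zero = (\<lambda>s\<in>S. \<zero>\<^bsub>R\<^esub>),
     add = (\<lambda>c d. \<lambda>s\<in>S. c s \<oplus>\<^bsub>R\<^esub> d s),
     smult = (\<lambda>a c. \<lambda>s\<in>S. a \<otimes>\<^bsub>R\<^esub> c s)\<rparr>"

definition module_dsum :: "'i set \<Rightarrow> ('i \<Rightarrow> ('r, 'v) module) \<Rightarrow> ('r, 'i \<Rightarrow> 'v) module" where
  "module_dsum I M = \<lparr>
     carrier = {v \<in> \<Pi>\<^sub>E i\<in>I. carrier (M i). finite {i \<in> I. v i \<noteq> \<zero>\<^bsub>M i\<^esub>}},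
     monoid.mult = undefined, one = undefined,
     zero = (\<lambda>i\<in>I. \<zero>\<^bsub>M i\<^esub>),
     add = (\<lambda>v w. \<lambda>i\<in>I. v i \<oplus>\<^bsub>M i\<^esub> w i),
     smult = (\<lambda>a v. \<lambda>i\<in>I. a \<odot>\<^bsub>M i\<^esub> v i)\<rparr>"

section \<open>Modules over a category\<close>

record ('o, 'a, 'r, 'v) cmod =
  val :: "'o \<Rightarrow> ('r, 'v) module"
  act :: "'o \<Rightarrow> 'o \<Rightarrow> 'a \<Rightarrow> 'v \<Rightarrow> 'v"

locale cmodule =
  fixes R :: "('r, 'x) ring_scheme" and C :: "('o, 'a) cat" and V :: "('o, 'a, 'r, 'v) cmod"
  assumes val_module: "x \<in> obs C \<Longrightarrow> module R (val V x)"
    and act_hom: "\<lbrakk>x \<in> obs C; y \<in> obs C; f \<in> homs C x y\<rbrakk>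
      \<Longrightarrow> act V x y f \<in> module_hom R (val V x) (val V y)"
    and act_ident: "\<lbrakk>x \<in> obs C; v \<in> carrier (val V x)\<rbrakk> \<Longrightarrow> act V x x (ident C x) v = v"
    and act_cmp: "\<lbrakk>x \<in> obs C; y \<in> obs C; z \<in> obs C; f \<in> homs C x y; g \<in> homs C y z;
        v \<in> carrier (val V x)\<rbrakk>
      \<Longrightarrow> act V x z (cmp C x y z g f) v = act V y z g (act V x y f v)"

definition cmod_hom :: "('r, 'x) ring_scheme \<Rightarrow> ('o, 'a) cat \<Rightarrow> ('o, 'a, 'r, 'v) cmod \<Rightarrow>
    ('o, 'a, 'r, 'w) cmod \<Rightarrow> ('o \<Rightarrow> 'v \<Rightarrow> 'w) set" where
  "cmod_hom R C V W = {\<phi>.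
     (\<forall>x\<in>obs C. \<phi> x \<in> module_hom R (val V x) (val W x)) \<and>
     (\<forall>x\<in>obs C. \<forall>y\<in>obs C. \<forall>f\<in>homs C x y. \<forall>v\<in>carrier (val V x).
        \<phi> y (act V x y f v) = act W x y f (\<phi> x v))}"

definition cmod_surj :: "('o, 'a) cat \<Rightarrow> ('o, 'a, 'r, 'v) cmod \<Rightarrow> ('o, 'a, 'r, 'w) cmod \<Rightarrow>
    ('o \<Rightarrow> 'v \<Rightarrow> 'w) \<Rightarrow> bool" where
  "cmod_surj C V W \<phi> \<longleftrightarrow> (\<forall>x\<in>obs C. \<phi> x ` carrier (val V x) = carrier (val W x))"

text \<open>A submodule is given by its values, submodules \<open>H x\<close> of \<open>val V x\<close> preserved by all arrows.\<close>

definition csubmodule :: "('o \<Rightarrow> 'v set) \<Rightarrow> ('r, 'x) ring_scheme \<Rightarrow> ('o, 'a) cat \<Rightarrow>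
    ('o, 'a, 'r, 'v) cmod \<Rightarrow> bool" where
  "csubmodule H R C V \<longleftrightarrow>
     (\<forall>x\<in>obs C. submodule (H x) R (val V x)) \<and>
     (\<forall>x\<in>obs C. \<forall>y\<in>obs C. \<forall>f\<in>homs C x y. act V x y f ` H x \<subseteq> H y)"

definition sub_cmod :: "('o, 'a, 'r, 'v) cmod \<Rightarrow> ('o \<Rightarrow> 'v set) \<Rightarrow> ('o, 'a, 'r, 'v) cmod" where
  "sub_cmod V H = V\<lparr>val := (\<lambda>x. (val V x)\<lparr>carrier := H x\<rparr>)\<rparr>"

text \<open>\<open>principal R C x\<close> is the linearization of the representable functor \<open>C(x, -)\<close>: an arrow
  \<open>g : y \<rightarrow> z\<close> sends \<open>\<Sum>\<^sub>f c\<^sub>f f\<close> to \<open>\<Sum>\<^sub>f c\<^sub>f (g \<circ> f)\<close>. The sum over the fibre is restricted to the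
  support of \<open>c\<close> so that it is finite for arbitrary \<open>C\<close>.\<close>

definition principal :: "('r, 'x) ring_scheme \<Rightarrow> ('o, 'a) cat \<Rightarrow> 'o \<Rightarrow>
    ('o, 'a, 'r, 'a \<Rightarrow> 'r) cmod" where
  "principal R C x = \<lparr>
     val = (\<lambda>y. free_module R (homs C x y)),
     act = (\<lambda>y z g c. \<lambda>h\<in>homs C x z.
       \<Oplus>\<^bsub>R\<^esub>f\<in>{f \<in> homs C x y. c f \<noteq> \<zero>\<^bsub>R\<^esub> \<and> cmp C x y z g f = h}. c f)\<rparr>"

definition cmod_dsum :: "'i set \<Rightarrow> ('i \<Rightarrow> ('o, 'a, 'r, 'v) cmod) \<Rightarrow>
    ('o, 'a, 'r, 'i \<Rightarrow> 'v) cmod" where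
  "cmod_dsum I F = \<lparr>
     val = (\<lambda>x. module_dsum I (\<lambda>i. val (F i) x)),
     act = (\<lambda>x y f v. \<lambda>i\<in>I. act (F i) x y f (v i))\<rparr>"

text \<open>\<open>free_cmod R C a\<close> is the direct sum over all objects \<open>x\<close> of \<open>a x\<close> copies of
  \<open>principal R C x\<close>.\<close>

definition free_cmod :: "('r, 'x) ring_scheme \<Rightarrow> ('o, 'a) cat \<Rightarrow> ('o \<Rightarrow> nat) \<Rightarrow>
    ('o, 'a, 'r, 'o \<times> nat \<Rightarrow> 'a \<Rightarrow> 'r) cmod" where
  "free_cmod R C a = cmod_dsum (SIGMA x:obs C. {1..a x}) (\<lambda>(x, j). principal R C x)"

text \<open>A family of natural numbers has finite sum iff it has finite support.\<close>

definition finitely_generated :: "('r, 'x) ring_scheme \<Rightarrow> ('o, 'a) cat \<Rightarrow>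
    ('o, 'a, 'r, 'v) cmod \<Rightarrow> bool" where
  "finitely_generated R C V \<longleftrightarrow>
     (\<exists>a. finite {x \<in> obs C. a x \<noteq> 0} \<and>
        (\<exists>\<phi>\<in>cmod_hom R C (free_cmod R C a) V. cmod_surj C (free_cmod R C a) V \<phi>))"

text \<open>A definition in HOL cannot quantify over types, so the type \<^typ>\<open>'v\<close> in which the values of
  the modules live is a parameter. It is unrestricted, so a theorem concluding
  \<open>locally_noetherian TYPE('v) R C\<close> with \<^typ>\<open>'v\<close> free covers modules with values in any type.\<close>

definition locally_noetherian :: "'v itself \<Rightarrow> ('r, 'x) ring_scheme \<Rightarrow> ('o, 'a) cat \<Rightarrow> bool" where
  "locally_noetherian _ R C \<longleftrightarrow>
     (\<forall>(V :: ('o, 'a, 'r, 'v) cmod) H.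
        cmodule R C V \<and> finitely_generated R C V \<and> csubmodule H R C V \<longrightarrow>
        finitely_generated R C (sub_cmod V H))"

end

theory Submission
  imports Defs "HOL-Library.Infinite_Set"
begin

text \<open>The proof is Hilbert's basis theorem carried out with Groebner bases over a category.

  A finitely generated module \<open>V\<close> over \<open>FI\<^sup>m\<close> is spanned at each object \<open>x\<close> by the translates
  \<open>f g\<^sub>i\<close> of finitely many generators \<open>g\<^sub>i\<close>, one for each arrow \<open>f\<close> into \<open>x\<close>. These translates
  serve as monomials. All arrows carry monomials to monomials, but only tuples of increasing maps
  are compatible with an order on them: the lexicographic order on the values of \<open>f\<close>. So
  divisibility of monomials is taken with respect to increasing maps only. A submodule is closed
  under these in particular, and finding finitely many generators for this smaller supply of arrows
  is more than enough.

  What makes it work is that divisibility is a well-quasi-order. An injection \<open>[n] \<rightarrow> [t]\<close> is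
  given by the relative order of its values and by the lengths of the gaps between them, and one
  injection divides another when the orders agree and no gap shrinks (lemma
  \<open>increasing_extension\<close>). For fixed \<open>n\<close> these are finitely many natural numbers, so Dickson's lemma produces an infinite divisibility chain in every sequence
  of monomials (lemma \<open>FI_pow_divisible_subseq\<close>).

  Given that, the leading coefficients along such a chain lie in a Noetherian ring, so one of them
  is a combination of earlier ones; the leading term of that element can be cancelled, and a choice
  of elements with minimal leading terms shows that finitely many span the submodule (lemma
  \<open>csubmodule_finitely_spanned\<close>). Leading terms are taken in \<open>V\<close> itself and not in a free module
  above it, at the price of not being unique.

  Finite generation by a surjection from a sum of principal modules is translated to and from
  spanning by a finite set of elements (lemmas \<open>finitely_generated_imp_cspan\<close> and
  \<open>cspan_imp_finitely_generated\<close>).\<close>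

section \<open>Spans in modules over a category\<close>

text \<open>The module record fixes only the operations, so spans are built up from them directly;
  an argument about linear combinations is then an induction on their formation.\<close>

inductive_set lin_span :: "('r, 'x) ring_scheme \<Rightarrow> ('r, 'v, 'y) module_scheme \<Rightarrow> 'v set \<Rightarrow> 'v set"
  for R M S where
  zero: "\<zero>\<^bsub>M\<^esub> \<in> lin_span R M S"
| base: "s \<in> S \<Longrightarrow> s \<in> lin_span R M S"
| add: "\<lbrakk>v \<in> lin_span R M S; w \<in> lin_span R M S\<rbrakk> \<Longrightarrow> v \<oplus>\<^bsub>M\<^esub> w \<in> lin_span R M S"
| smult: "\<lbrakk>a \<in> carrier R; v \<in> lin_span R M S\<rbrakk> \<Longrightarrow> a \<odot>\<^bsub>M\<^esub> v \<in> lin_span R M S"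

lemma lin_span_mono: "S \<subseteq> T \<Longrightarrow> lin_span R M S \<subseteq> lin_span R M T"
proof
  fix v assume "S \<subseteq> T" "v \<in> lin_span R M S"
  from this(2,1) show "v \<in> lin_span R M T"
    by induction (auto intro: lin_span.intros)
qed

lemma lin_span_minimal:
  assumes "submodule H R M" "S \<subseteq> H"
  shows "lin_span R M S \<subseteq> H"
proof
  interpret submodule H R M by fact
  fix v assume "v \<in> lin_span R M S"
  then show "v \<in> H"
    using assms(2) one_closed m_closed by induction auto
qed

lemma (in module) lin_span_submodule:
  assumes "S \<subseteq> carrier M"
  shows "submodule (lin_span R M S) R M"
proof (rule submoduleI)
  show sub: "lin_span R M S \<subseteq> carrier M"
    using lin_span_minimal[OF carrier_is_submodule assms] .
  show "\<ominus>\<^bsub>M\<^esub> v \<in> lin_span R M S" if "v \<in> lin_span R M S" for v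
  proof -
    have "\<ominus>\<^bsub>M\<^esub> v = (\<ominus> \<one>) \<odot>\<^bsub>M\<^esub> v"
      using sub that smult_l_minus[of \<one> v] by auto
    then show ?thesis
      using that by (auto intro: lin_span.smult)
  qed
qed (auto intro: lin_span.intros)

lemma module_homD:
  assumes "h \<in> module_hom R M N"
  shows "v \<in> carrier M \<Longrightarrow> h v \<in> carrier N"
    and "\<lbrakk>v \<in> carrier M; w \<in> carrier M\<rbrakk> \<Longrightarrow> h (v \<oplus>\<^bsub>M\<^esub> w) = h v \<oplus>\<^bsub>N\<^esub> h w"
    and "\<lbrakk>a \<in> carrier R; v \<in> carrier M\<rbrakk> \<Longrightarrow> h (a \<odot>\<^bsub>M\<^esub> v) = a \<odot>\<^bsub>N\<^esub> h v"
  using assms by (auto simp: module_hom_def hom_def)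

text \<open>The source is assumed to satisfy only \<open>0 + 0 = 0\<close>: this spares a proof that the free modules
  below satisfy the module axioms.\<close>
lemma module_hom_zero:
  assumes "module R N" "h \<in> module_hom R M N" "\<zero>\<^bsub>M\<^esub> \<in> carrier M" "\<zero>\<^bsub>M\<^esub> \<oplus>\<^bsub>M\<^esub> \<zero>\<^bsub>M\<^esub> = \<zero>\<^bsub>M\<^esub>"
  shows "h \<zero>\<^bsub>M\<^esub> = \<zero>\<^bsub>N\<^esub>"
proof -
  interpret N: module R N by fact
  have "h \<zero>\<^bsub>M\<^esub> \<oplus>\<^bsub>N\<^esub> h \<zero>\<^bsub>M\<^esub> = h \<zero>\<^bsub>M\<^esub>"
    using module_homD(2)[OF assms(2,3,3)] assms(4) by simp
  then show ?thesis
    using module_homD(1)[OF assms(2,3)] by (simp add: N.add.l_cancel_one')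
qed

lemma lin_span_image:
  assumes "module R M" "module R N" and h: "h \<in> module_hom R M N"
    and S: "S \<subseteq> carrier M" and v: "v \<in> lin_span R M S"
  shows "h v \<in> lin_span R N (h ` S)"
proof -
  interpret M: module R M by fact
  have sub: "lin_span R M S \<subseteq> carrier M"
    using M.submoduleE(1)[OF M.lin_span_submodule[OF S]] .
  from v show ?thesis
  proof induction
    case zero
    then show ?case
      using module_hom_zero[OF assms(2) h] by (simp add: lin_span.zero)
  next
    case (base s)
    then show ?case by (simp add: lin_span.base)
  next
    case (add v w)
    then have "v \<in> carrier M" "w \<in> carrier M" using sub by auto
    with add show ?case by (simp add: module_homD(2)[OF h] lin_span.add)
  next
    case (smult a v)
    then have "v \<in> carrier M" using sub by auto
    with smult show ?case by (simp add: module_homD(3)[OF h] lin_span.smult)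
  qed
qed

text \<open>In contrast to \<open>lin_span\<close>, closure under arrows needs no recursion: applying an arrow to
  \<open>f v\<close> gives \<open>(g f) v\<close>, so the translates of \<open>S\<close> span a family that all arrows preserve.\<close>
definition cspan :: "('r, 'x) ring_scheme \<Rightarrow> ('o, 'a) cat \<Rightarrow> ('o, 'a, 'r, 'v) cmod \<Rightarrow>
    ('o \<times> 'v) set \<Rightarrow> 'o \<Rightarrow> 'v set" where
  "cspan R C V S x = lin_span R (val V x) {act V y x f v |y f v. (y, v) \<in> S \<and> f \<in> homs C y x}"

context cmodule
begin

lemma act_closed:
  "\<lbrakk>x \<in> obs C; y \<in> obs C; f \<in> homs C x y; v \<in> carrier (val V x)\<rbrakk> \<Longrightarrow> act V x y f v \<in> carrier (val V y)"
  using module_homD(1)[OF act_hom] by blast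

lemma cspan_generators:
  assumes "S \<subseteq> Sigma (obs C) (\<lambda>y. carrier (val V y))" "x \<in> obs C"
  shows "{act V y x f v |y f v. (y, v) \<in> S \<and> f \<in> homs C y x} \<subseteq> carrier (val V x)"
  using assms act_closed by fastforce

lemma cspan_submodule:
  assumes "S \<subseteq> Sigma (obs C) (\<lambda>y. carrier (val V y))" "x \<in> obs C"
  shows "submodule (cspan R C V S x) R (val V x)"
  unfolding cspan_def
  by (rule module.lin_span_submodule[OF val_module[OF assms(2)] cspan_generators[OF assms]])

lemma csubmodule_subset:
  assumes "csubmodule H R C V" "x \<in> obs C"
  shows "H x \<subseteq> carrier (val V x)"
  using assms module.submoduleE(1)[OF val_module] unfolding csubmodule_def by blast

lemma cspan_minimal:
  assumes H: "csubmodule H R C V" and S: "S \<subseteq> Sigma (obs C) H" and x: "x \<in> obs C"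
  shows "cspan R C V S x \<subseteq> H x"
  unfolding cspan_def
proof (rule lin_span_minimal)
  show "submodule (H x) R (val V x)" using H x by (simp add: csubmodule_def)
  have "act V y x f v \<in> H x" if "(y, v) \<in> S" "f \<in> homs C y x" for y f v
  proof -
    have "y \<in> obs C" "v \<in> H y" using S that by auto
    then show ?thesis using H x that unfolding csubmodule_def by blast
  qed
  then show "{act V y x f v |y f v. (y, v) \<in> S \<and> f \<in> homs C y x} \<subseteq> H x" by blast
qed

end

section \<open>Finite generation by elements\<close>

definition free_index :: "('o, 'a) cat \<Rightarrow> ('o \<Rightarrow> nat) \<Rightarrow> ('o \<times> nat) set" where
  "free_index C a = (SIGMA x:obs C. {1..a x})"

text \<open>The coefficients of an element of the free module are doubly indexed, by a summand and then by an arrow; pairing the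
  two indices lets one finite sum run over the whole basis.\<close>
definition free_basis :: "('o, 'a) cat \<Rightarrow> ('o \<Rightarrow> nat) \<Rightarrow> 'o \<Rightarrow> (('o \<times> nat) \<times> 'a) set" where
  "free_basis C a y = (SIGMA i:free_index C a. homs C (fst i) y)"

definition free_delta :: "('r, 'x) ring_scheme \<Rightarrow> ('o, 'a) cat \<Rightarrow> ('o \<Rightarrow> nat) \<Rightarrow> 'o \<Rightarrow>
    ('o \<times> nat) \<times> 'a \<Rightarrow> 'o \<times> nat \<Rightarrow> 'a \<Rightarrow> 'r" where
  "free_delta R C a y b = (\<lambda>i\<in>free_index C a. \<lambda>f\<in>homs C (fst i) y.
     if (i, f) = b then \<one>\<^bsub>R\<^esub> else \<zero>\<^bsub>R\<^esub>)"

lemma finite_free_index: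
  assumes "finite {x \<in> obs C. a x \<noteq> 0}"
  shows "finite (free_index C a)"
proof -
  have "free_index C a = (SIGMA x:{x \<in> obs C. a x \<noteq> 0}. {1..a x})"
    unfolding free_index_def by auto
  then show ?thesis using assms by simp
qed

text \<open>With finite hom sets and finitely many summands, the finite-support conditions in the direct
  sum and in the principal modules hold automatically.\<close>
locale finite_free_cmod = cring R
  for R :: "('r, 'x) ring_scheme" and C :: "('o, 'a) cat" +
  fixes a :: "'o \<Rightarrow> nat"
  assumes finite_homs: "\<lbrakk>x \<in> obs C; y \<in> obs C\<rbrakk> \<Longrightarrow> finite (homs C x y)"
    and finite_support: "finite {x \<in> obs C. a x \<noteq> 0}"
begin

abbreviation "F \<equiv> free_cmod R C a"
abbreviation "I \<equiv> free_index C a"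

lemma fst_index: "i \<in> I \<Longrightarrow> fst i \<in> obs C"
  by (auto simp: free_index_def)

lemma finite_basis: "y \<in> obs C \<Longrightarrow> finite (free_basis C a y)"
  unfolding free_basis_def using finite_free_index[OF finite_support] finite_homs fst_index by auto

lemma free_carrier:
  assumes "y \<in> obs C"
  shows "carrier (val F y) = (\<Pi>\<^sub>E i\<in>I. homs C (fst i) y \<rightarrow>\<^sub>E carrier R)"
proof -
  have fin: "finite {i \<in> I. P i}" for P using finite_free_index[OF finite_support] by simp
  have "finite {f \<in> homs C (fst i) y. P f}" if "i \<in> I" for i P
    using finite_homs[OF fst_index[OF that] assms] by simp
  then have "carrier (free_module R (homs C (fst i) y)) = homs C (fst i) y \<rightarrow>\<^sub>E carrier R"
    if "i \<in> I" for i
    using that by (simp add: free_module_def)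
  then show ?thesis
    unfolding free_cmod_def cmod_dsum_def module_dsum_def principal_def free_index_def[symmetric]
    by (simp add: case_prod_beta fin cong: PiE_cong)
qed

lemma free_ops:
  "\<zero>\<^bsub>val F y\<^esub> = (\<lambda>i\<in>I. \<lambda>f\<in>homs C (fst i) y. \<zero>\<^bsub>R\<^esub>)"
  "v \<oplus>\<^bsub>val F y\<^esub> w = (\<lambda>i\<in>I. \<lambda>f\<in>homs C (fst i) y. v i f \<oplus>\<^bsub>R\<^esub> w i f)"
  "c \<odot>\<^bsub>val F y\<^esub> v = (\<lambda>i\<in>I. \<lambda>f\<in>homs C (fst i) y. c \<otimes>\<^bsub>R\<^esub> v i f)"
  "act F y z h v = (\<lambda>i\<in>I. \<lambda>f'\<in>homs C (fst i) z.
     \<Oplus>\<^bsub>R\<^esub>f\<in>{f \<in> homs C (fst i) y. v i f \<noteq> \<zero>\<^bsub>R\<^esub> \<and> cmp C (fst i) y z h f = f'}. v i f)"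
  unfolding free_cmod_def cmod_dsum_def module_dsum_def principal_def free_module_def
    free_index_def[symmetric]
  by (simp_all add: case_prod_beta)

lemma free_coeff:
  assumes "y \<in> obs C" "v \<in> carrier (val F y)" "i \<in> I" "f \<in> homs C (fst i) y"
  shows "v i f \<in> carrier R"
  using assms by (auto simp: free_carrier PiE_iff)

lemma free_closed:
  assumes y: "y \<in> obs C"
  shows "\<zero>\<^bsub>val F y\<^esub> \<in> carrier (val F y)"
    and "\<lbrakk>v \<in> carrier (val F y); w \<in> carrier (val F y)\<rbrakk> \<Longrightarrow> v \<oplus>\<^bsub>val F y\<^esub> w \<in> carrier (val F y)"
    and "\<lbrakk>c \<in> carrier R; v \<in> carrier (val F y)\<rbrakk> \<Longrightarrow> c \<odot>\<^bsub>val F y\<^esub> v \<in> carrier (val F y)"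
    and "free_delta R C a y b \<in> carrier (val F y)"
  using free_coeff[OF y]
  by (simp_all add: free_carrier[OF y] free_ops free_delta_def PiE_iff)

lemma free_ext:
  assumes y: "y \<in> obs C" and "v \<in> carrier (val F y)" "w \<in> carrier (val F y)"
    and "\<And>i f. (i, f) \<in> free_basis C a y \<Longrightarrow> v i f = w i f"
  shows "v = w"
proof (rule PiE_ext)
  show "v \<in> (\<Pi>\<^sub>E i\<in>I. homs C (fst i) y \<rightarrow>\<^sub>E carrier R)" "w \<in> (\<Pi>\<^sub>E i\<in>I. homs C (fst i) y \<rightarrow>\<^sub>E carrier R)"
    using assms free_carrier by auto
  then show "v i = w i" if "i \<in> I" for i
    using that assms(4) by (intro PiE_ext[of _ "homs C (fst i) y" "\<lambda>_. carrier R"])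
      (auto simp: PiE_iff free_basis_def)
qed

lemma free_delta_act:
  assumes b: "(i, f) \<in> free_basis C a y"
  shows "act F y z h (free_delta R C a y (i, f)) = free_delta R C a z (i, cmp C (fst i) y z h f)"
proof -
  have i: "i \<in> I" "f \<in> homs C (fst i) y" using b by (auto simp: free_basis_def)
  have "(\<Oplus>\<^bsub>R\<^esub>f''\<in>{f'' \<in> homs C (fst i') y. free_delta R C a y (i, f) i' f'' \<noteq> \<zero>\<^bsub>R\<^esub>
        \<and> cmp C (fst i') y z h f'' = f'}. free_delta R C a y (i, f) i' f'')
      = free_delta R C a z (i, cmp C (fst i) y z h f) i' f'"
    if i': "i' \<in> I" "f' \<in> homs C (fst i') z" for i' f'
  \<comment> \<open>Over the zero ring the delta function vanishes as well, hence the third condition.\<close>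
  proof (cases "i' = i \<and> f' = cmp C (fst i) y z h f \<and> \<one>\<^bsub>R\<^esub> \<noteq> \<zero>\<^bsub>R\<^esub>")
    case True
    then have "{f'' \<in> homs C (fst i') y. free_delta R C a y (i, f) i' f'' \<noteq> \<zero>\<^bsub>R\<^esub>
        \<and> cmp C (fst i') y z h f'' = f'} = {f}"
      using i by (auto simp: free_delta_def)
    then show ?thesis using True i i' by (simp add: free_delta_def)
  next
    case False
    then have "{f'' \<in> homs C (fst i') y. free_delta R C a y (i, f) i' f'' \<noteq> \<zero>\<^bsub>R\<^esub>
        \<and> cmp C (fst i') y z h f'' = f'} = {}"
      using i i' by (auto simp: free_delta_def)
    then have "(\<Oplus>\<^bsub>R\<^esub>f''\<in>{f'' \<in> homs C (fst i') y. free_delta R C a y (i, f) i' f'' \<noteq> \<zero>\<^bsub>R\<^esub>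
        \<and> cmp C (fst i') y z h f'' = f'}. free_delta R C a y (i, f) i' f'') = \<zero>\<^bsub>R\<^esub>"
      by (simp only: finsum_empty)
    then show ?thesis using False i' by (auto simp: free_delta_def)
  qed
  moreover have "free_delta R C a z b' = (\<lambda>i'\<in>I. \<lambda>f'\<in>homs C (fst i') z. free_delta R C a z b' i' f')" for b'
    by (auto simp: free_delta_def fun_eq_iff)
  ultimately show ?thesis
    unfolding free_ops(4) by (metis (mono_tags, lifting) restrict_ext)
qed

text \<open>Induction on a finite set containing the support, splitting off one coordinate at a time.\<close>
lemma free_image_in_lin_span:
  assumes M: "module R M" and \<phi>: "\<phi> \<in> module_hom R (val F y) M" and y: "y \<in> obs C"
    and v: "v \<in> carrier (val F y)"
  shows "\<phi> v \<in> lin_span R M ((\<lambda>b. \<phi> (free_delta R C a y b)) ` free_basis C a y)" (is "_ \<in> ?L")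
proof -
  interpret M: module R M by fact
  have "\<phi> v \<in> ?L" if "finite D" "v \<in> carrier (val F y)" "D \<subseteq> free_basis C a y"
    "\<And>i f. (i, f) \<in> free_basis C a y - D \<Longrightarrow> v i f = \<zero>\<^bsub>R\<^esub>" for D v
    using that
  proof (induction arbitrary: v)
    case empty
    have "v = \<zero>\<^bsub>val F y\<^esub>"
      using empty free_closed(1)[OF y]
      by (intro free_ext[OF y]) (auto simp: free_ops free_basis_def)
    moreover have "\<zero>\<^bsub>val F y\<^esub> \<oplus>\<^bsub>val F y\<^esub> \<zero>\<^bsub>val F y\<^esub> = \<zero>\<^bsub>val F y\<^esub>"
      unfolding free_ops by (auto intro!: restrict_ext)
    ultimately show ?case
      using module_hom_zero[OF M \<phi> free_closed(1)[OF y]] by (simp add: lin_span.zero)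
  next
    case (insert b D)
    obtain i f where b: "b = (i, f)" by fastforce
    have i: "i \<in> I" "f \<in> homs C (fst i) y" using insert.prems b by (auto simp: free_basis_def)
    define w where "w = (\<lambda>i'\<in>I. \<lambda>f'\<in>homs C (fst i') y. if (i', f') = b then \<zero>\<^bsub>R\<^esub> else v i' f')"
    have c: "v i f \<in> carrier R" using free_coeff[OF y] insert.prems i by blast
    have w: "w \<in> carrier (val F y)"
      using free_coeff[OF y insert.prems(1)] by (auto simp: w_def free_carrier[OF y] PiE_iff)
    have "\<phi> w \<in> ?L"
    proof (rule insert.IH[OF w])
      show "D \<subseteq> free_basis C a y" using insert.prems by simp
      show "w i' f' = \<zero>\<^bsub>R\<^esub>" if "(i', f') \<in> free_basis C a y - D" for i' f'
        using insert.prems(3)[of i' f'] that by (auto simp: w_def free_basis_def)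
    qed
    moreover have "v = w \<oplus>\<^bsub>val F y\<^esub> v i f \<odot>\<^bsub>val F y\<^esub> free_delta R C a y b"
    proof (rule free_ext[OF y insert.prems(1)])
      show "w \<oplus>\<^bsub>val F y\<^esub> v i f \<odot>\<^bsub>val F y\<^esub> free_delta R C a y b \<in> carrier (val F y)"
        using w c free_closed[OF y] by simp
      fix i' f' assume "(i', f') \<in> free_basis C a y"
      then show "v i' f' = (w \<oplus>\<^bsub>val F y\<^esub> v i f \<odot>\<^bsub>val F y\<^esub> free_delta R C a y b) i' f'"
        using c free_coeff[OF y insert.prems(1)]
        by (auto simp: free_ops w_def b free_basis_def free_delta_def)
    qed
    then have "\<phi> v = \<phi> w \<oplus>\<^bsub>M\<^esub> v i f \<odot>\<^bsub>M\<^esub> \<phi> (free_delta R C a y b)"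
      using module_homD[OF \<phi>] w c free_closed[OF y] by metis
    moreover have "\<phi> (free_delta R C a y b) \<in> ?L"
      using insert.prems(2) by (intro lin_span.base) auto
    ultimately show ?case
      using c by (simp add: lin_span.add lin_span.smult)
  qed
  from this[OF finite_basis[OF y] v] show ?thesis by blast
qed

end

text \<open>As in the Yoneda lemma, a map out of a free module is determined by the images of the
  identity arrows; these images are the finite spanning set.\<close>
lemma finitely_generated_imp_cspan:
  assumes "category C" "cring R" "cmodule R C V"
    and fin: "\<And>x y. \<lbrakk>x \<in> obs C; y \<in> obs C\<rbrakk> \<Longrightarrow> finite (homs C x y)"
    and "finitely_generated R C V"
  obtains S where "finite S" "S \<subseteq> Sigma (obs C) (\<lambda>x. carrier (val V x))"
    "\<And>x. x \<in> obs C \<Longrightarrow> carrier (val V x) = cspan R C V S x"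
proof -
  interpret category C by fact
  interpret V: cmodule R C V by fact
  obtain a \<phi> where a: "finite {x \<in> obs C. a x \<noteq> 0}"
    and \<phi>: "\<phi> \<in> cmod_hom R C (free_cmod R C a) V" "cmod_surj C (free_cmod R C a) V \<phi>"
    using assms(5) unfolding finitely_generated_def by blast
  interpret finite_free_cmod R C a
    by (intro finite_free_cmod.intro finite_free_cmod_axioms.intro assms(2) fin a)
  have hom: "\<phi> x \<in> module_hom R (val F x) (val V x)" if "x \<in> obs C" for x
    using \<phi>(1) that unfolding cmod_hom_def by blast
  have nat: "\<phi> y (act F x y f v) = act V x y f (\<phi> x v)"
    if "x \<in> obs C" "y \<in> obs C" "f \<in> homs C x y" "v \<in> carrier (val F x)" for x y f v
    using \<phi>(1) that unfolding cmod_hom_def by blast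
  define g where "g i = \<phi> (fst i) (free_delta R C a (fst i) (i, ident C (fst i)))" for i
  have g: "g i \<in> carrier (val V (fst i))" if "i \<in> I" for i
    unfolding g_def using fst_index[OF that] hom free_closed(4) module_homD(1) by metis
  have S: "(\<lambda>i. (fst i, g i)) ` I \<subseteq> Sigma (obs C) (\<lambda>x. carrier (val V x))"
    using fst_index g by auto
  have act: "\<phi> y (free_delta R C a y (i, f)) = act V (fst i) y f (g i)"
    if y: "y \<in> obs C" and b: "(i, f) \<in> free_basis C a y" for y i f
  proof -
    have i: "i \<in> I" "f \<in> homs C (fst i) y" using b by (auto simp: free_basis_def)
    note o = fst_index[OF i(1)]
    have "act F (fst i) y f (free_delta R C a (fst i) (i, ident C (fst i))) = free_delta R C a y (i, f)"
      using free_delta_act[of i "ident C (fst i)" "fst i" y f] i o ident_closed cmp_ident_right y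
      by (simp add: free_basis_def)
    then show ?thesis
      unfolding g_def using nat[OF o y i(2) free_closed(4)[OF o]] by metis
  qed
  have "carrier (val V y) = cspan R C V ((\<lambda>i. (fst i, g i)) ` I) y" if y: "y \<in> obs C" for y
  proof
    show "carrier (val V y) \<subseteq> cspan R C V ((\<lambda>i. (fst i, g i)) ` I) y"
    proof
      fix v assume "v \<in> carrier (val V y)"
      then obtain c where c: "c \<in> carrier (val F y)" "v = \<phi> y c"
        using \<phi>(2) y unfolding cmod_surj_def by blast
      have "\<phi> y c \<in> lin_span R (val V y) ((\<lambda>b. \<phi> y (free_delta R C a y b)) ` free_basis C a y)"
        using free_image_in_lin_span[OF V.val_module[OF y] hom[OF y] y c(1)] .
      also have "\<dots> \<subseteq> cspan R C V ((\<lambda>i. (fst i, g i)) ` I) y"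
        unfolding cspan_def
      proof (rule lin_span_mono, rule image_subsetI)
        fix b assume b: "b \<in> free_basis C a y"
        then obtain i f where i: "b = (i, f)" "i \<in> I" "f \<in> homs C (fst i) y"
          by (auto simp: free_basis_def)
        then have "\<phi> y (free_delta R C a y b) = act V (fst i) y f (g i)" using act[OF y] b by simp
        then show "\<phi> y (free_delta R C a y b) \<in>
            {act V x y f v |x f v. (x, v) \<in> (\<lambda>i. (fst i, g i)) ` I \<and> f \<in> homs C x y}"
          using i by blast
      qed
      finally show "v \<in> cspan R C V ((\<lambda>i. (fst i, g i)) ` I) y" using c by simp
    qed
    show "cspan R C V ((\<lambda>i. (fst i, g i)) ` I) y \<subseteq> carrier (val V y)"
      using module.submoduleE(1)[OF V.val_module[OF y] V.cspan_submodule[OF S y]] .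
  qed
  then show ?thesis
    using that[of "(\<lambda>i. (fst i, g i)) ` I"] S finite_free_index[OF finite_support] by blast
qed

text \<open>Summation over the fibres of \<open>\<pi>\<close>. The restriction to the support of \<open>c\<close> matches the
  action of arrows on principal modules, for which this is naturality.\<close>
lemma (in module) finsum_fibres:
  assumes "finite A" "finite B" "\<pi> \<in> A \<rightarrow> B" "c \<in> A \<rightarrow> carrier R" "w \<in> B \<rightarrow> carrier M"
  shows "(\<Oplus>\<^bsub>M\<^esub>b\<in>B. (\<Oplus>\<^bsub>R\<^esub>x\<in>{x \<in> A. c x \<noteq> \<zero> \<and> \<pi> x = b}. c x) \<odot>\<^bsub>M\<^esub> w b)
    = (\<Oplus>\<^bsub>M\<^esub>x\<in>A. c x \<odot>\<^bsub>M\<^esub> w (\<pi> x))"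
  using assms(1,3,4)
proof induction
  case empty
  have "(\<Oplus>\<^bsub>M\<^esub>b\<in>B. (\<Oplus>\<^bsub>R\<^esub>x\<in>{x \<in> {}. c x \<noteq> \<zero> \<and> \<pi> x = b}. c x) \<odot>\<^bsub>M\<^esub> w b) = (\<Oplus>\<^bsub>M\<^esub>b\<in>B. \<zero>\<^bsub>M\<^esub>)"
    using assms(5) by (intro M.finsum_cong') (auto simp: Pi_iff)
  then show ?case by simp
next
  case (insert y A)
  let ?s = "\<lambda>b. (\<Oplus>\<^bsub>R\<^esub>x\<in>{x \<in> A. c x \<noteq> \<zero> \<and> \<pi> x = b}. c x)"
  have y: "\<pi> y \<in> B" "c y \<in> carrier R" "w (\<pi> y) \<in> carrier M"
    using insert.prems assms(5) by auto
  have s: "?s b \<in> carrier R" for b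
    using insert.prems by (intro R.finsum_closed) auto
  have w: "w b \<in> carrier M" if "b \<in> B" for b using assms(5) that by auto
  have step: "(\<Oplus>\<^bsub>R\<^esub>x\<in>{x \<in> insert y A. c x \<noteq> \<zero> \<and> \<pi> x = b}. c x) \<odot>\<^bsub>M\<^esub> w b
      = ?s b \<odot>\<^bsub>M\<^esub> w b \<oplus>\<^bsub>M\<^esub> (if \<pi> y = b then c y \<odot>\<^bsub>M\<^esub> w b else \<zero>\<^bsub>M\<^esub>)" if "b \<in> B" for b
  proof (cases "c y \<noteq> \<zero> \<and> \<pi> y = b")
    case True
    then have "{x \<in> insert y A. c x \<noteq> \<zero> \<and> \<pi> x = b} = insert y {x \<in> A. c x \<noteq> \<zero> \<and> \<pi> x = b}"
      by auto
    moreover have "(\<Oplus>\<^bsub>R\<^esub>x\<in>insert y {x \<in> A. c x \<noteq> \<zero> \<and> \<pi> x = b}. c x) = c y \<oplus>\<^bsub>R\<^esub> ?s b"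
      using insert by (intro R.finsum_insert) auto
    ultimately show ?thesis
      using True y s w[OF that] by (simp add: smult_l_distr M.a_comm)
  next
    case False
    then have "{x \<in> insert y A. c x \<noteq> \<zero> \<and> \<pi> x = b} = {x \<in> A. c x \<noteq> \<zero> \<and> \<pi> x = b}"
      by auto
    then show ?thesis using False y s w[OF that] by auto
  qed
  have "(\<Oplus>\<^bsub>M\<^esub>b\<in>B. (\<Oplus>\<^bsub>R\<^esub>x\<in>{x \<in> insert y A. c x \<noteq> \<zero> \<and> \<pi> x = b}. c x) \<odot>\<^bsub>M\<^esub> w b)
      = (\<Oplus>\<^bsub>M\<^esub>b\<in>B. ?s b \<odot>\<^bsub>M\<^esub> w b \<oplus>\<^bsub>M\<^esub> (if \<pi> y = b then c y \<odot>\<^bsub>M\<^esub> w b else \<zero>\<^bsub>M\<^esub>))"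
    using step s w y by (intro M.finsum_cong') auto
  also have "\<dots> = (\<Oplus>\<^bsub>M\<^esub>b\<in>B. ?s b \<odot>\<^bsub>M\<^esub> w b)
      \<oplus>\<^bsub>M\<^esub> (\<Oplus>\<^bsub>M\<^esub>b\<in>B. if \<pi> y = b then c y \<odot>\<^bsub>M\<^esub> w b else \<zero>\<^bsub>M\<^esub>)"
    using s w y by (intro M.finsum_addf) auto
  also have "(\<Oplus>\<^bsub>M\<^esub>b\<in>B. if \<pi> y = b then c y \<odot>\<^bsub>M\<^esub> w b else \<zero>\<^bsub>M\<^esub>) = c y \<odot>\<^bsub>M\<^esub> w (\<pi> y)"
    using y w assms(2) by (intro M.finsum_singleton) auto
  also have "(\<Oplus>\<^bsub>M\<^esub>b\<in>B. ?s b \<odot>\<^bsub>M\<^esub> w b) = (\<Oplus>\<^bsub>M\<^esub>x\<in>A. c x \<odot>\<^bsub>M\<^esub> w (\<pi> x))"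
    using insert by auto
  finally show ?case
    using insert.hyps insert.prems assms(5) y
    by (subst M.finsum_insert) (auto simp: Pi_iff M.a_comm)
qed

text \<open>The converse, for submodules: take one copy of the principal module at \<open>x\<close> for each
  \<open>(x, v)\<close> in \<open>S\<close> and send its identity arrow to \<open>v\<close>. The map is built into the ambient module,
  where all module laws are at hand, and its image is then seen to be \<open>H\<close>.\<close>
lemma cspan_imp_finitely_generated:
  assumes "category C" "cring R" "cmodule R C V"
    and fin: "\<And>x y. \<lbrakk>x \<in> obs C; y \<in> obs C\<rbrakk> \<Longrightarrow> finite (homs C x y)"
    and H: "csubmodule H R C V"
    and S: "finite S" "S \<subseteq> Sigma (obs C) H" "\<And>x. x \<in> obs C \<Longrightarrow> H x = cspan R C V S x"
  shows "finitely_generated R C (sub_cmod V H)"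
proof -
  interpret category C by fact
  interpret V: cmodule R C V by fact
  define Sx where "Sx x = {v. (x, v) \<in> S}" for x
  define a where "a x = card (Sx x)" for x
  have finSx: "finite (Sx x)" for x
    unfolding Sx_def using finite_vimageI[OF S(1), of "Pair x"] by (simp add: vimage_def inj_def)
  have "{x \<in> obs C. a x \<noteq> 0} \<subseteq> fst ` S"
  proof
    fix x assume "x \<in> {x \<in> obs C. a x \<noteq> 0}"
    then have "Sx x \<noteq> {}" using card.empty a_def by force
    then show "x \<in> fst ` S" unfolding Sx_def by force
  qed
  then have a: "finite {x \<in> obs C. a x \<noteq> 0}" using S(1) finite_surj by blast
  interpret finite_free_cmod R C a
    by (intro finite_free_cmod.intro finite_free_cmod_axioms.intro assms(2) fin a)
  obtain en where en: "\<And>x. bij_betw (en x) {1..a x} (Sx x)"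
    using ex_bij_betw_nat_finite_1[OF finSx] unfolding a_def by metis
  define g where "g i = en (fst i) (snd i)" for i
  have gS: "(fst i, g i) \<in> S" if "i \<in> I" for i
    using that en[of "fst i"] unfolding free_index_def g_def bij_betw_def Sx_def by fastforce
  have gI: "\<exists>i\<in>I. x = fst i \<and> v = g i" if "(x, v) \<in> S" for x v
  proof -
    have "v \<in> en x ` {1..a x}" using en[of x] that by (simp add: bij_betw_def Sx_def)
    then show ?thesis using that S(2) by (auto simp: free_index_def g_def)
  qed
  have SV: "S \<subseteq> Sigma (obs C) (\<lambda>x. carrier (val V x))"
    using S(2) V.csubmodule_subset[OF H] by fastforce
  define m where "m y b = act V (fst (fst b)) y (snd b) (g (fst b))" for y b
  define \<phi> where "\<phi> y v = (\<Oplus>\<^bsub>val V y\<^esub>b\<in>free_basis C a y. v (fst b) (snd b) \<odot>\<^bsub>val V y\<^esub> m y b)" for y v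
  have m: "m y b \<in> carrier (val V y)" if "y \<in> obs C" "b \<in> free_basis C a y" for y b
    using that SV gS fst_index unfolding m_def free_basis_def by (force intro!: V.act_closed)
  have mH: "m y b \<in> H y" if y: "y \<in> obs C" "b \<in> free_basis C a y" for y b
  proof -
    have "fst b \<in> I" and hom: "snd b \<in> homs C (fst (fst b)) y"
      using y(2) by (auto simp: free_basis_def)
    then have "fst (fst b) \<in> obs C" "g (fst b) \<in> H (fst (fst b))"
      using subsetD[OF S(2) gS] by auto
    with hom show ?thesis using H y(1) unfolding m_def csubmodule_def by blast
  qed
  have coeff: "v (fst b) (snd b) \<in> carrier R"
    if "y \<in> obs C" "v \<in> carrier (val F y)" "b \<in> free_basis C a y" for y v b
    using that free_coeff by (auto simp: free_basis_def)
  have hom: "\<phi> y \<in> module_hom R (val F y) (val V y)" if y: "y \<in> obs C" for y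
  proof -
    interpret M: module R "val V y" using V.val_module[OF y] .
    have "\<phi> y v \<in> carrier (val V y)" if "v \<in> carrier (val F y)" for v
      unfolding \<phi>_def using m[OF y] coeff[OF y that] by (intro M.M.finsum_closed) auto
    moreover have "\<phi> y (v \<oplus>\<^bsub>val F y\<^esub> w) = \<phi> y v \<oplus>\<^bsub>val V y\<^esub> \<phi> y w"
      if v: "v \<in> carrier (val F y)" and w: "w \<in> carrier (val F y)" for v w
    proof -
      have "\<phi> y (v \<oplus>\<^bsub>val F y\<^esub> w) = (\<Oplus>\<^bsub>val V y\<^esub>b\<in>free_basis C a y.
          v (fst b) (snd b) \<odot>\<^bsub>val V y\<^esub> m y b \<oplus>\<^bsub>val V y\<^esub> w (fst b) (snd b) \<odot>\<^bsub>val V y\<^esub> m y b)"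
        unfolding \<phi>_def
      proof (rule M.M.finsum_cong'[OF refl])
        fix b assume b: "b \<in> free_basis C a y"
        then have "(v \<oplus>\<^bsub>val F y\<^esub> w) (fst b) (snd b) = v (fst b) (snd b) \<oplus>\<^bsub>R\<^esub> w (fst b) (snd b)"
          by (auto simp: free_ops free_basis_def)
        then show "(v \<oplus>\<^bsub>val F y\<^esub> w) (fst b) (snd b) \<odot>\<^bsub>val V y\<^esub> m y b
            = v (fst b) (snd b) \<odot>\<^bsub>val V y\<^esub> m y b \<oplus>\<^bsub>val V y\<^esub> w (fst b) (snd b) \<odot>\<^bsub>val V y\<^esub> m y b"
          by (simp only: M.smult_l_distr[OF coeff[OF y v b] coeff[OF y w b] m[OF y b]])
      qed (use m[OF y] coeff[OF y v] coeff[OF y w] in auto)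
      also have "\<dots> = \<phi> y v \<oplus>\<^bsub>val V y\<^esub> \<phi> y w"
        unfolding \<phi>_def using m[OF y] coeff[OF y v] coeff[OF y w]
        by (intro M.M.finsum_addf) auto
      finally show ?thesis .
    qed
    moreover have "\<phi> y (c \<odot>\<^bsub>val F y\<^esub> v) = c \<odot>\<^bsub>val V y\<^esub> \<phi> y v"
      if v: "v \<in> carrier (val F y)" and c: "c \<in> carrier R" for v c
    proof -
      have "\<phi> y (c \<odot>\<^bsub>val F y\<^esub> v) = (\<Oplus>\<^bsub>val V y\<^esub>b\<in>free_basis C a y.
          c \<odot>\<^bsub>val V y\<^esub> (v (fst b) (snd b) \<odot>\<^bsub>val V y\<^esub> m y b))"
        unfolding \<phi>_def
      proof (rule M.M.finsum_cong'[OF refl])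
        fix b assume b: "b \<in> free_basis C a y"
        then have "(c \<odot>\<^bsub>val F y\<^esub> v) (fst b) (snd b) = c \<otimes>\<^bsub>R\<^esub> v (fst b) (snd b)"
          by (auto simp: free_ops free_basis_def)
        then show "(c \<odot>\<^bsub>val F y\<^esub> v) (fst b) (snd b) \<odot>\<^bsub>val V y\<^esub> m y b
            = c \<odot>\<^bsub>val V y\<^esub> (v (fst b) (snd b) \<odot>\<^bsub>val V y\<^esub> m y b)"
          by (simp only: M.smult_assoc1[OF c coeff[OF y v b] m[OF y b]])
      qed (use m[OF y] coeff[OF y v] c in auto)
      also have "\<dots> = c \<odot>\<^bsub>val V y\<^esub> \<phi> y v"
        unfolding \<phi>_def using m[OF y] coeff[OF y v] c
        by (intro M.finsum_smult_ldistr[symmetric] finite_basis[OF y]) auto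
      finally show ?thesis .
    qed
    ultimately show ?thesis by (simp add: module_hom_def hom_def)
  qed
  \<comment> \<open>Naturality: postcomposition with \<open>h\<close> acts on the basis by \<open>\<pi>\<close>, whose fibres are the
    index sets in the action of \<open>h\<close>.\<close>
  have nat: "\<phi> z (act F y z h v) = act V y z h (\<phi> y v)"
    if y: "y \<in> obs C" and z: "z \<in> obs C" and h: "h \<in> homs C y z" and v: "v \<in> carrier (val F y)"
    for y z h v
  proof -
    interpret M: module R "val V y" using V.val_module[OF y] .
    interpret N: module R "val V z" using V.val_module[OF z] .
    note hh = V.act_hom[OF y z h]
    define \<pi> where "\<pi> b = (fst b, cmp C (fst (fst b)) y z h (snd b))" for b :: "('a \<times> nat) \<times> 'b"
    have \<pi>: "\<pi> b \<in> free_basis C a z" if "b \<in> free_basis C a y" for b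
      using that y z h fst_index cmp_closed by (auto simp: \<pi>_def free_basis_def)
    have m\<pi>: "act V y z h (m y b) = m z (\<pi> b)" if b: "b \<in> free_basis C a y" for b
    proof -
      have "fst b \<in> I" "snd b \<in> homs C (fst (fst b)) y" using b by (auto simp: free_basis_def)
      then show ?thesis
        using V.act_cmp[OF fst_index y z _ h] SV gS[of "fst b"] unfolding m_def \<pi>_def by fastforce
    qed
    have fibre: "act F y z h v (fst b') (snd b')
        = (\<Oplus>\<^bsub>R\<^esub>b\<in>{b \<in> free_basis C a y. v (fst b) (snd b) \<noteq> \<zero>\<^bsub>R\<^esub> \<and> \<pi> b = b'}. v (fst b) (snd b))"
      if b': "b' \<in> free_basis C a z" for b'
    proof -
      obtain i f' where i: "b' = (i, f')" "i \<in> I" "f' \<in> homs C (fst i) z"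
        using b' by (auto simp: free_basis_def)
      let ?P = "{f \<in> homs C (fst i) y. v i f \<noteq> \<zero>\<^bsub>R\<^esub> \<and> cmp C (fst i) y z h f = f'}"
      have "{b \<in> free_basis C a y. v (fst b) (snd b) \<noteq> \<zero>\<^bsub>R\<^esub> \<and> \<pi> b = b'} = Pair i ` ?P"
        using i by (auto simp: \<pi>_def free_basis_def)
      moreover have "(\<Oplus>\<^bsub>R\<^esub>b\<in>Pair i ` ?P. v (fst b) (snd b)) = (\<Oplus>\<^bsub>R\<^esub>f\<in>?P. v i f)"
        using free_coeff[OF y v i(2)] by (subst finsum_reindex) (auto simp: inj_on_def)
      ultimately show ?thesis using i by (simp add: free_ops)
    qed
    have "\<phi> z (act F y z h v) = (\<Oplus>\<^bsub>val V z\<^esub>b'\<in>free_basis C a z.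
        (\<Oplus>\<^bsub>R\<^esub>b\<in>{b \<in> free_basis C a y. v (fst b) (snd b) \<noteq> \<zero>\<^bsub>R\<^esub> \<and> \<pi> b = b'}. v (fst b) (snd b))
          \<odot>\<^bsub>val V z\<^esub> m z b')"
      unfolding \<phi>_def using fibre m[OF z] coeff[OF y v]
      by (intro N.M.finsum_cong') (auto intro!: N.smult_closed finsum_closed)
    also have "\<dots> = (\<Oplus>\<^bsub>val V z\<^esub>b\<in>free_basis C a y. v (fst b) (snd b) \<odot>\<^bsub>val V z\<^esub> m z (\<pi> b))"
      using finite_basis[OF y] finite_basis[OF z] \<pi> coeff[OF y v] m[OF z]
      by (intro N.finsum_fibres) auto
    also have "\<dots> = (\<Oplus>\<^bsub>val V z\<^esub>b\<in>free_basis C a y. act V y z h (v (fst b) (snd b) \<odot>\<^bsub>val V y\<^esub> m y b))"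
      using m\<pi> coeff[OF y v] m[OF y] m[OF z] \<pi>
      by (intro N.M.finsum_cong') (auto simp: module_homD[OF hh])
    also have "\<dots> = act V y z h (\<phi> y v)"
    proof -
      have "(\<Oplus>\<^bsub>val V z\<^esub>b\<in>D. act V y z h (k b)) = act V y z h (\<Oplus>\<^bsub>val V y\<^esub>b\<in>D. k b)"
        if "finite D" "k \<in> D \<rightarrow> carrier (val V y)" for D and k :: "('a \<times> nat) \<times> 'b \<Rightarrow> _"
        using that
      proof induction
        case empty
        then show ?case using module_hom_zero[OF N.module_axioms hh] by simp
      next
        case (insert b D)
        then show ?case by (simp add: module_homD[OF hh] Pi_iff M.M.finsum_closed)
      qed
      then show ?thesis
        unfolding \<phi>_def using finite_basis[OF y] m[OF y] coeff[OF y v] by auto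
    qed
    finally show ?thesis .
  qed
  have image: "\<phi> y ` carrier (val F y) = H y" if y: "y \<in> obs C" for y
  proof
    interpret M: module R "val V y" using V.val_module[OF y] .
    have delta: "\<phi> y (free_delta R C a y b) = m y b" if b: "b \<in> free_basis C a y" for b
    proof -
      have "\<phi> y (free_delta R C a y b)
          = (\<Oplus>\<^bsub>val V y\<^esub>b'\<in>free_basis C a y. if b = b' then m y b' else \<zero>\<^bsub>val V y\<^esub>)"
        unfolding \<phi>_def using m[OF y]
        by (intro M.M.finsum_cong') (auto simp: free_delta_def free_basis_def)
      also have "\<dots> = m y b"
        using b m[OF y] finite_basis[OF y] by (intro M.M.finsum_singleton) auto
      finally show ?thesis .
    qed
    have sub: "submodule (H y) R (val V y)" using H y by (simp add: csubmodule_def)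
    show "\<phi> y ` carrier (val F y) \<subseteq> H y"
    proof
      fix u assume "u \<in> \<phi> y ` carrier (val F y)"
      then have "u \<in> lin_span R (val V y) ((\<lambda>b. \<phi> y (free_delta R C a y b)) ` free_basis C a y)"
        using free_image_in_lin_span[OF M.module_axioms hom[OF y] y] by blast
      also have "\<dots> \<subseteq> H y"
        by (rule lin_span_minimal[OF sub]) (auto simp: delta mH[OF y])
      finally show "u \<in> H y" .
    qed
    show "H y \<subseteq> \<phi> y ` carrier (val F y)"
    proof
      fix u assume "u \<in> H y"
      then have "u \<in> cspan R C V S y" using S(3)[OF y] by simp
      then show "u \<in> \<phi> y ` carrier (val F y)"
        unfolding cspan_def
      proof induction
        case zero
        have "\<zero>\<^bsub>val F y\<^esub> \<oplus>\<^bsub>val F y\<^esub> \<zero>\<^bsub>val F y\<^esub> = \<zero>\<^bsub>val F y\<^esub>"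
          unfolding free_ops by (auto intro!: restrict_ext)
        then have "\<phi> y \<zero>\<^bsub>val F y\<^esub> = \<zero>\<^bsub>val V y\<^esub>"
          using module_hom_zero[OF M.module_axioms hom[OF y] free_closed(1)[OF y]] by simp
        then show ?case using free_closed(1)[OF y] by (metis imageI)
      next
        case (base s)
        then obtain i f where "i \<in> I" "f \<in> homs C (fst i) y" "s = act V (fst i) y f (g i)"
          using gI by blast
        then have "s = \<phi> y (free_delta R C a y (i, f))"
          using delta[of "(i, f)"] by (simp add: m_def free_basis_def)
        then show ?case using free_closed(4)[OF y] by blast
      next
        case (add v w)
        then obtain v' w' where *: "v' \<in> carrier (val F y)" "w' \<in> carrier (val F y)"
          "v = \<phi> y v'" "w = \<phi> y w'" by blast
        then have "v \<oplus>\<^bsub>val V y\<^esub> w = \<phi> y (v' \<oplus>\<^bsub>val F y\<^esub> w')"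
          using module_homD(2)[OF hom[OF y]] by simp
        then show ?case using free_closed(2)[OF y *(1,2)] by (rule image_eqI)
      next
        case (smult c v)
        then obtain v' where *: "v' \<in> carrier (val F y)" "v = \<phi> y v'" by blast
        then have "c \<odot>\<^bsub>val V y\<^esub> v = \<phi> y (c \<odot>\<^bsub>val F y\<^esub> v')"
          using module_homD(3)[OF hom[OF y] smult(1)] by simp
        then show ?case using free_closed(3)[OF y smult(1) *(1)] by (rule image_eqI)
      qed
    qed
  qed
  have "\<phi> y v \<in> H y" if "y \<in> obs C" "v \<in> carrier (val F y)" for y v
    using image that by blast
  then have "\<phi> \<in> cmod_hom R C F (sub_cmod V H)"
    using hom nat
    unfolding cmod_hom_def sub_cmod_def module_hom_def hom_def by auto
  moreover have "cmod_surj C F (sub_cmod V H) \<phi>"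
    using image unfolding cmod_surj_def sub_cmod_def by simp
  ultimately show ?thesis
    unfolding finitely_generated_def using a by blast
qed

section \<open>Groebner bases over a category\<close>

text \<open>The ascending chain condition in the form of Hilbert's basis theorem: the ideals generated by
  the initial segments of a sequence stabilize, so some term lies in the ideal of its
  predecessors.\<close>
lemma (in noetherian_ring) sequence_redundant:
  assumes c: "\<And>k::nat. c k \<in> carrier R"
  obtains j where "c j \<in> Idl (c ` {..<j})"
proof -
  define I where "I k = Idl (c ` {..<k})" for k
  have id: "ideal (I k) R" for k
    unfolding I_def using c by (intro genideal_ideal) auto
  have mono: "I k \<subseteq> I l" if "k \<le> l" for k l
    unfolding I_def
  proof (rule genideal_minimal)
    show "ideal (Idl (c ` {..<l})) R" using id by (simp add: I_def)
    have "c ` {..<l} \<subseteq> Idl (c ` {..<l})" using c by (intro genideal_self) auto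
    then show "c ` {..<k} \<subseteq> Idl (c ` {..<l})" using that by auto
  qed
  have "subset.chain {I. ideal I R} (range I)"
    unfolding subset_chain_def using id mono by (auto; metis nat_le_linear subsetD)
  then have "\<Union>(range I) \<in> range I" by (intro ideal_chain_is_trivial) auto
  then obtain j where "\<Union>(range I) = I j" by auto
  moreover have "c j \<in> I (Suc j)"
    unfolding I_def using genideal_self[of "c ` {..<Suc j}"] c by auto
  ultimately have "c j \<in> I j" by blast
  then show ?thesis using that unfolding I_def by blast
qed

text \<open>The setting of Groebner bases. The elements \<open>e x b\<close> are the monomials of the value at \<open>x\<close>;
  they have to span it, but they may satisfy linear relations. The arrows in \<open>arr\<close> carry
  monomials to monomials and respect the monomial order; they need not exhaust the category, and
  for \<open>FI\<^sup>m\<close> they cannot in general, since a nontrivial permutation of a finite set respects no total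
  order. The last assumption says that divisibility of monomials through such arrows is a
  well-quasi-order, in the form of an infinite chain inside every sequence.\<close>
locale monomial_cmodule = cmodule R C V
  for R :: "('r, 'x) ring_scheme" and C :: "('o, 'a) cat" and V :: "('o, 'a, 'r, 'v) cmod" +
  fixes B :: "'o \<Rightarrow> 'b set" and e :: "'o \<Rightarrow> 'b \<Rightarrow> 'v" and less :: "('b \<times> 'b) set"
    and arr :: "'o \<Rightarrow> 'o \<Rightarrow> 'a set" and push :: "'o \<Rightarrow> 'o \<Rightarrow> 'a \<Rightarrow> 'b \<Rightarrow> 'b"
  assumes wf_less: "wf less" and trans_less: "trans less"
    and total_less: "x \<in> obs C \<Longrightarrow> total_on (B x) less"
    and e_closed: "\<lbrakk>x \<in> obs C; b \<in> B x\<rbrakk> \<Longrightarrow> e x b \<in> carrier (val V x)"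
    and e_span: "x \<in> obs C \<Longrightarrow> carrier (val V x) \<subseteq> lin_span R (val V x) (e x ` B x)"
    and arr_homs: "\<lbrakk>x \<in> obs C; y \<in> obs C\<rbrakk> \<Longrightarrow> arr x y \<subseteq> homs C x y"
    and push_closed: "\<lbrakk>x \<in> obs C; y \<in> obs C; h \<in> arr x y; b \<in> B x\<rbrakk> \<Longrightarrow> push x y h b \<in> B y"
    and act_e: "\<lbrakk>x \<in> obs C; y \<in> obs C; h \<in> arr x y; b \<in> B x\<rbrakk>
      \<Longrightarrow> act V x y h (e x b) = e y (push x y h b)"
    and push_less: "\<lbrakk>x \<in> obs C; y \<in> obs C; h \<in> arr x y; b \<in> B x; c \<in> B x; (b, c) \<in> less\<rbrakk>
      \<Longrightarrow> (push x y h b, push x y h c) \<in> less"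
    and divisible_subseq: "\<And>x b. (\<And>k::nat. x k \<in> obs C \<and> b k \<in> B (x k)) \<Longrightarrow>
      \<exists>\<phi>::nat \<Rightarrow> nat. strict_mono \<phi> \<and>
        (\<forall>i j. i < j \<longrightarrow> (\<exists>h\<in>arr (x (\<phi> i)) (x (\<phi> j)). push (x (\<phi> i)) (x (\<phi> j)) h (b (\<phi> i)) = b (\<phi> j)))"
begin

definition lower :: "'o \<Rightarrow> 'b \<Rightarrow> 'v set" where
  "lower x b = lin_span R (val V x) (e x ` {c \<in> B x. (c, b) \<in> less})"

text \<open>Because the monomials may be dependent, an element has no well-defined leading monomial.
  The relation \<open>lead\<close> says that \<open>c\<close> times the monomial \<open>b\<close> leads in some expression of \<open>v\<close>;
  the coefficient \<open>c\<close> may be zero.\<close>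
definition lead :: "'o \<Rightarrow> 'b \<Rightarrow> 'r \<Rightarrow> 'v \<Rightarrow> bool" where
  "lead x b c v \<longleftrightarrow> b \<in> B x \<and> c \<in> carrier R \<and>
     (\<exists>u\<in>lower x b. v = u \<oplus>\<^bsub>val V x\<^esub> c \<odot>\<^bsub>val V x\<^esub> e x b)"

lemma lower_submodule: "x \<in> obs C \<Longrightarrow> submodule (lower x b) R (val V x)"
  unfolding lower_def using e_closed by (intro module.lin_span_submodule val_module) auto

lemma lead_lower:
  assumes x: "x \<in> obs C" and v: "lead x b c v" and "(b, b') \<in> less"
  shows "v \<in> lower x b'"
proof -
  interpret M: module R "val V x" using val_module[OF x] .
  have "lower x b \<subseteq> lower x b'"
    unfolding lower_def using assms(3) trans_less by (intro lin_span_mono) (auto dest: transD)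
  moreover have "e x b \<in> lower x b'"
    unfolding lower_def using assms by (intro lin_span.base) (auto simp: lead_def)
  ultimately show ?thesis
    using v M.submoduleE(4,5)[OF lower_submodule[OF x]] unfolding lead_def by blast
qed

lemma lead_add_lower:
  assumes x: "x \<in> obs C" and v: "lead x b c v" and w: "w \<in> lower x b"
  shows "lead x b c (w \<oplus>\<^bsub>val V x\<^esub> v)"
proof -
  interpret M: module R "val V x" using val_module[OF x] .
  note L = M.submoduleE[OF lower_submodule[OF x, of b]]
  obtain u where u: "u \<in> lower x b" "v = u \<oplus>\<^bsub>val V x\<^esub> c \<odot>\<^bsub>val V x\<^esub> e x b"
    and c: "c \<in> carrier R" and b: "b \<in> B x" using v unfolding lead_def by blast
  have "w \<oplus>\<^bsub>val V x\<^esub> v = (w \<oplus>\<^bsub>val V x\<^esub> u) \<oplus>\<^bsub>val V x\<^esub> c \<odot>\<^bsub>val V x\<^esub> e x b"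
    using u w c L(1) e_closed[OF x b] by (simp add: M.a_assoc subsetD)
  then show ?thesis using L(5)[OF w u(1)] b c unfolding lead_def by blast
qed

lemma lead_add:
  assumes x: "x \<in> obs C" and v: "lead x b c v" and w: "lead x b d w"
  shows "lead x b (c \<oplus>\<^bsub>R\<^esub> d) (v \<oplus>\<^bsub>val V x\<^esub> w)"
proof -
  interpret M: module R "val V x" using val_module[OF x] .
  note L = M.submoduleE[OF lower_submodule[OF x, of b]]
  obtain u where u: "u \<in> lower x b" "v = u \<oplus>\<^bsub>val V x\<^esub> c \<odot>\<^bsub>val V x\<^esub> e x b"
    and c: "c \<in> carrier R" and b: "b \<in> B x" using v unfolding lead_def by blast
  obtain u' where u': "u' \<in> lower x b" "w = u' \<oplus>\<^bsub>val V x\<^esub> d \<odot>\<^bsub>val V x\<^esub> e x b"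
    and d: "d \<in> carrier R" using w unfolding lead_def by blast
  have "u \<in> carrier (val V x)" "u' \<in> carrier (val V x)" using u(1) u'(1) L(1) by auto
  then have "v \<oplus>\<^bsub>val V x\<^esub> w = (u \<oplus>\<^bsub>val V x\<^esub> u') \<oplus>\<^bsub>val V x\<^esub> (c \<oplus>\<^bsub>R\<^esub> d) \<odot>\<^bsub>val V x\<^esub> e x b"
    using u(2) u'(2) c d e_closed[OF x b] by (simp add: M.smult_l_distr M.a_ac)
  then show ?thesis using L(5)[OF u(1) u'(1)] b c d unfolding lead_def by blast
qed

lemma lead_smult:
  assumes x: "x \<in> obs C" and v: "lead x b c v" and a: "a \<in> carrier R"
  shows "lead x b (a \<otimes>\<^bsub>R\<^esub> c) (a \<odot>\<^bsub>val V x\<^esub> v)"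
proof -
  interpret M: module R "val V x" using val_module[OF x] .
  note L = M.submoduleE[OF lower_submodule[OF x, of b]]
  obtain u where u: "u \<in> lower x b" "v = u \<oplus>\<^bsub>val V x\<^esub> c \<odot>\<^bsub>val V x\<^esub> e x b"
    and c: "c \<in> carrier R" and b: "b \<in> B x" using v unfolding lead_def by blast
  have "u \<in> carrier (val V x)" using u(1) L(1) by auto
  then have "a \<odot>\<^bsub>val V x\<^esub> v = a \<odot>\<^bsub>val V x\<^esub> u \<oplus>\<^bsub>val V x\<^esub> (a \<otimes>\<^bsub>R\<^esub> c) \<odot>\<^bsub>val V x\<^esub> e x b"
    using u(2) c a e_closed[OF x b] by (simp add: M.smult_r_distr M.smult_assoc1)
  then show ?thesis using L(4)[OF a u(1)] b c a unfolding lead_def by blast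
qed

text \<open>Since the order is total, the larger of two leading terms leads in the sum.\<close>
lemma lead_exists:
  assumes x: "x \<in> obs C" and D: "D \<subseteq> B x" and v: "v \<in> lin_span R (val V x) (e x ` D)"
  shows "v = \<zero>\<^bsub>val V x\<^esub> \<or> (\<exists>b\<in>D. \<exists>c. lead x b c v)"
proof -
  interpret M: module R "val V x" using val_module[OF x] .
  have sub: "lin_span R (val V x) (e x ` D) \<subseteq> carrier (val V x)"
    using M.submoduleE(1)[OF M.lin_span_submodule] D e_closed[OF x] by blast
  from v show ?thesis
  proof induction
    case zero
    then show ?case by simp
  next
    case (base s)
    then obtain b where b: "b \<in> D" "s = e x b" by auto
    then have "b \<in> B x" "e x b \<in> carrier (val V x)" using D e_closed[OF x] by auto
    then have "s = \<zero>\<^bsub>val V x\<^esub> \<oplus>\<^bsub>val V x\<^esub> \<one>\<^bsub>R\<^esub> \<odot>\<^bsub>val V x\<^esub> e x b"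
      using b by simp
    then have "lead x b \<one>\<^bsub>R\<^esub> s"
      using \<open>b \<in> B x\<close> lin_span.zero unfolding lead_def lower_def by blast
    then show ?case using b by blast
  next
    case (add v w)
    have C: "v \<in> carrier (val V x)" "w \<in> carrier (val V x)" using add.hyps sub by auto
    consider "v = \<zero>\<^bsub>val V x\<^esub>" | "w = \<zero>\<^bsub>val V x\<^esub>" |
      b c b' c' where "b \<in> D" "lead x b c v" "b' \<in> D" "lead x b' c' w"
      using add.IH by blast
    then show ?case
    proof cases
      case 1
      then show ?thesis using add.IH C by simp
    next
      case 2
      then show ?thesis using add.IH C by simp
    next
      case 3
      have "b = b' \<or> (b, b') \<in> less \<or> (b', b) \<in> less"
        using total_less[OF x] 3 D unfolding total_on_def by blast
      then consider "b = b'" | "(b, b') \<in> less" | "(b', b) \<in> less" by blast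
      then show ?thesis
      proof cases
        case 1
        then show ?thesis using lead_add[OF x] 3 by blast
      next
        case 2
        then show ?thesis using lead_add_lower[OF x 3(4) lead_lower[OF x 3(2)]] 3 by blast
      next
        case less: 3
        have "lead x b c (w \<oplus>\<^bsub>val V x\<^esub> v)"
          by (rule lead_add_lower[OF x 3(2) lead_lower[OF x 3(4) less]])
        then show ?thesis using 3 C by (auto simp: M.a_comm)
      qed
    qed
  next
    case (smult a v)
    then show ?case using lead_smult[OF x _ smult.hyps(1)] M.smult_r_null by metis
  qed
qed

text \<open>An order-preserving arrow moves the leading term to the leading term, with the same
  coefficient. This is why the order has to be compatible with \<open>arr\<close>.\<close>
lemma lead_act:
  assumes x: "x \<in> obs C" and y: "y \<in> obs C" and h: "h \<in> arr x y" and v: "lead x b c v"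
  shows "lead y (push x y h b) c (act V x y h v)"
proof -
  interpret M: module R "val V x" using val_module[OF x] .
  interpret N: module R "val V y" using val_module[OF y] .
  obtain u where u: "u \<in> lower x b" "v = u \<oplus>\<^bsub>val V x\<^esub> c \<odot>\<^bsub>val V x\<^esub> e x b"
    and c: "c \<in> carrier R" and b: "b \<in> B x" using v unfolding lead_def by blast
  have h': "act V x y h \<in> module_hom R (val V x) (val V y)"
    using act_hom[OF x y] arr_homs[OF x y] h by blast
  have uC: "u \<in> carrier (val V x)" using u(1) M.submoduleE(1)[OF lower_submodule[OF x]] by blast
  have "act V x y h u \<in> lin_span R (val V y) (act V x y h ` e x ` {c \<in> B x. (c, b) \<in> less})"
    using e_closed[OF x] u(1) unfolding lower_def
    by (intro lin_span_image[OF M.module_axioms N.module_axioms h']) auto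
  also have "\<dots> \<subseteq> lower y (push x y h b)"
    unfolding lower_def
  proof (rule lin_span_mono)
    show "act V x y h ` e x ` {c \<in> B x. (c, b) \<in> less} \<subseteq> e y ` {c \<in> B y. (c, push x y h b) \<in> less}"
      using act_e[OF x y h] push_closed[OF x y h] push_less[OF x y h _ b] by fastforce
  qed
  finally have "act V x y h u \<in> lower y (push x y h b)" .
  moreover have "act V x y h v
      = act V x y h u \<oplus>\<^bsub>val V y\<^esub> c \<odot>\<^bsub>val V y\<^esub> e y (push x y h b)"
    using u(2) uC c b e_closed[OF x b]
    by (simp add: module_homD[OF h'] act_e[OF x y h])
  ultimately show ?thesis
    using push_closed[OF x y h b] c unfolding lead_def by blast
qed

lemma lead_coefficients_ideal:
  assumes x: "x \<in> obs C" and b: "b \<in> B x" and G: "submodule G R (val V x)"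
  shows "ideal {c \<in> carrier R. \<exists>w\<in>G. lead x b c w} R"
proof -
  interpret M: module R "val V x" using val_module[OF x] .
  note GE = M.submoduleE[OF G]
  have zero: "lead x b \<zero>\<^bsub>R\<^esub> \<zero>\<^bsub>val V x\<^esub>"
    unfolding lead_def using e_closed[OF x b] b
    by (auto simp: lower_def intro!: bexI[OF _ lin_span.zero])
  have z: "\<zero>\<^bsub>val V x\<^esub> \<in> G"
    using subgroup.one_closed[OF submodule.axioms(1)[OF G]] by simp
  show ?thesis
  proof (rule idealI)
    show "ring R" by (rule M.R.ring_axioms)
    show "subgroup {c \<in> carrier R. \<exists>w\<in>G. lead x b c w} (add_monoid R)"
    proof (rule M.R.add.subgroupI)
      show "{c \<in> carrier R. \<exists>w\<in>G. lead x b c w} \<noteq> {}" using zero z by auto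
      fix c assume c: "c \<in> {c \<in> carrier R. \<exists>w\<in>G. lead x b c w}"
      then obtain w where w: "c \<in> carrier R" "w \<in> G" "lead x b c w" by blast
      have "lead x b ((\<ominus>\<^bsub>R\<^esub> \<one>\<^bsub>R\<^esub>) \<otimes>\<^bsub>R\<^esub> c) ((\<ominus>\<^bsub>R\<^esub> \<one>\<^bsub>R\<^esub>) \<odot>\<^bsub>val V x\<^esub> w)"
        using lead_smult[OF x w(3)] by simp
      moreover have "(\<ominus>\<^bsub>R\<^esub> \<one>\<^bsub>R\<^esub>) \<otimes>\<^bsub>R\<^esub> c = \<ominus>\<^bsub>R\<^esub> c" using w by (simp add: M.R.l_minus)
      ultimately show "\<ominus>\<^bsub>R\<^esub> c \<in> {c \<in> carrier R. \<exists>w\<in>G. lead x b c w}"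
        using GE(4)[OF _ w(2), of "\<ominus>\<^bsub>R\<^esub> \<one>\<^bsub>R\<^esub>"] w by auto
      fix d assume "d \<in> {c \<in> carrier R. \<exists>w\<in>G. lead x b c w}"
      then show "c \<oplus>\<^bsub>R\<^esub> d \<in> {c \<in> carrier R. \<exists>w\<in>G. lead x b c w}"
        using w lead_add[OF x] GE(5) by fastforce
    qed auto
    show l: "a \<otimes>\<^bsub>R\<^esub> c \<in> {c \<in> carrier R. \<exists>w\<in>G. lead x b c w}"
      if "c \<in> {c \<in> carrier R. \<exists>w\<in>G. lead x b c w}" "a \<in> carrier R" for a c
      using that lead_smult[OF x] GE(4) by fastforce
    show "c \<otimes>\<^bsub>R\<^esub> a \<in> {c \<in> carrier R. \<exists>w\<in>G. lead x b c w}"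
      if "c \<in> {c \<in> carrier R. \<exists>w\<in>G. lead x b c w}" "a \<in> carrier R" for a c
      using l[OF that] that by (simp add: M.R.m_comm)
  qed
qed

text \<open>Hilbert's argument. If no finite set spans \<open>H\<close>, choose \<open>v\<^sub>0, v\<^sub>1, \<dots>\<close> in turn outside the
  span of the earlier ones and with least possible leading monomial. Along a divisibility chain of
  these monomials, some leading coefficient lies in the ideal of the earlier ones. The
  corresponding combination of translates of earlier \<open>v\<^sub>i\<close> has the same leading term as the
  new element, so their difference is smaller; by minimality the difference is in the span, and
  hence so is the new element.\<close>
lemma csubmodule_finitely_spanned:
  assumes "noetherian_ring R" and H: "csubmodule H R C V"
  shows "\<exists>S. finite S \<and> S \<subseteq> Sigma (obs C) H \<and> (\<forall>x\<in>obs C. H x = cspan R C V S x)"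
proof (rule ccontr)
  interpret noetherian_ring R by fact
  note sub = csubmodule_subset[OF H]
  define minimal where "minimal S x v b c \<longleftrightarrow> x \<in> obs C \<and> v \<in> H x \<and> v \<notin> cspan R C V S x \<and> lead x b c v \<and>
      (\<forall>v' b' c'. v' \<in> H x \<and> lead x b' c' v' \<and> (b', b) \<in> less \<longrightarrow> v' \<in> cspan R C V S x)"
    for S x v b c
  assume none: "\<nexists>S. finite S \<and> S \<subseteq> Sigma (obs C) H \<and> (\<forall>x\<in>obs C. H x = cspan R C V S x)"
  have ex: "\<exists>x v b c. minimal S x v b c" if S: "finite S" "S \<subseteq> Sigma (obs C) H" for S
  proof -
    obtain x where x: "x \<in> obs C" "H x \<noteq> cspan R C V S x" using none S by blast
    then obtain v where v: "v \<in> H x" "v \<notin> cspan R C V S x"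
      using cspan_minimal[OF H S(2) x(1)] by blast
    define Q where "Q = {b. \<exists>v\<in>H x. v \<notin> cspan R C V S x \<and> (\<exists>c. lead x b c v)}"
    have "v \<noteq> \<zero>\<^bsub>val V x\<^esub>" using v(2) lin_span.zero unfolding cspan_def by auto
    then obtain b c where "lead x b c v"
      using lead_exists[OF x(1) subset_refl] e_span[OF x(1)] sub[OF x(1)] v(1) by blast
    then have "b \<in> Q" using v unfolding Q_def by blast
    then obtain b0 where b0: "b0 \<in> Q" "\<And>b'. (b', b0) \<in> less \<Longrightarrow> b' \<notin> Q"
      using wfE_min[OF wf_less] by metis
    then obtain v0 c0 where "v0 \<in> H x" "v0 \<notin> cspan R C V S x" "lead x b0 c0 v0"
      unfolding Q_def by blast
    then have "minimal S x v0 b0 c0"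
      unfolding minimal_def using b0(2) x(1) unfolding Q_def by blast
    then show ?thesis by blast
  qed
  define pick where "pick S = (SOME q. case q of (x, v, b, c) \<Rightarrow> minimal S x v b c)" for S
  have pick: "case pick S of (x, v, b, c) \<Rightarrow> minimal S x v b c"
    if S: "finite S" "S \<subseteq> Sigma (obs C) H" for S
    unfolding pick_def by (rule someI_ex) (use ex[OF that] in auto)
  \<comment> \<open>\<open>T k\<close> collects the first \<open>k\<close> chosen elements, each with its object.\<close>
  define T where "T = rec_nat {} (\<lambda>_ S. insert (fst (pick S), fst (snd (pick S))) S)"
  define x where "x k = fst (pick (T k))" for k
  define v where "v k = fst (snd (pick (T k)))" for k
  define b where "b k = fst (snd (snd (pick (T k))))" for k
  define c where "c k = snd (snd (snd (pick (T k))))" for k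
  have T_Suc: "T (Suc k) = insert (x k, v k) (T k)" for k
    by (simp add: T_def x_def v_def)
  have T: "finite (T k) \<and> T k \<subseteq> Sigma (obs C) H" for k
  proof (induction k)
    case 0
    then show ?case by (simp add: T_def)
  next
    case (Suc k)
    then have "minimal (T k) (x k) (v k) (b k) (c k)"
      using pick[of "T k"] by (simp add: x_def v_def b_def c_def split_beta)
    then show ?case using Suc T_Suc by (auto simp: minimal_def)
  qed
  have min: "minimal (T k) (x k) (v k) (b k) (c k)" for k
    using pick[of "T k"] T by (simp add: x_def v_def b_def c_def split_beta)
  have x: "x k \<in> obs C" and v: "v k \<in> H (x k)" and new: "v k \<notin> cspan R C V (T k) (x k)"
    and lead: "lead (x k) (b k) (c k) (v k)" for k
    using min[of k] unfolding minimal_def by auto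
  have bc: "b k \<in> B (x k)" "c k \<in> carrier R" for k
    using lead unfolding lead_def by auto
  have T_mono: "T k \<subseteq> T l" if "k \<le> l" for k l
    using that by (rule lift_Suc_mono_le[rotated]) (auto simp: T_Suc)
  obtain \<phi> :: "nat \<Rightarrow> nat" where \<phi>: "strict_mono \<phi>"
    and div: "\<And>i j. i < j \<Longrightarrow> \<exists>h\<in>arr (x (\<phi> i)) (x (\<phi> j)). push (x (\<phi> i)) (x (\<phi> j)) h (b (\<phi> i)) = b (\<phi> j)"
    using divisible_subseq[of x b] x bc by blast
  obtain j where j: "c (\<phi> j) \<in> Idl\<^bsub>R\<^esub> ((\<lambda>i. c (\<phi> i)) ` {..<j})"
    using sequence_redundant[of "\<lambda>i. c (\<phi> i)"] bc by blast
  define y where "y = x (\<phi> j)"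
  define G where "G = cspan R C V (T (\<phi> j)) y"
  have y: "y \<in> obs C" using x y_def by simp
  interpret M: module R "val V y" using val_module[OF y] .
  have TC: "T k \<subseteq> Sigma (obs C) (\<lambda>y. carrier (val V y))" for k
    using T[of k] sub by fastforce
  have G: "submodule G R (val V y)"
    unfolding G_def by (rule cspan_submodule[OF TC y])
  \<comment> \<open>The coefficients of \<open>b (\<phi> j)\<close> over the span of the earlier elements form an ideal, and
    each earlier coefficient is one of them: push its element along the chain.\<close>
  have "Idl\<^bsub>R\<^esub> ((\<lambda>i. c (\<phi> i)) ` {..<j}) \<subseteq> {a \<in> carrier R. \<exists>w\<in>G. lead y (b (\<phi> j)) a w}"
  proof (rule genideal_minimal)
    show "ideal {a \<in> carrier R. \<exists>w\<in>G. lead y (b (\<phi> j)) a w} R"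
      using lead_coefficients_ideal[OF y _ G] bc(1) y_def by simp
    show "(\<lambda>i. c (\<phi> i)) ` {..<j} \<subseteq> {a \<in> carrier R. \<exists>w\<in>G. lead y (b (\<phi> j)) a w}"
    proof (clarsimp simp: bc)
      fix i assume "i < j"
      then obtain h where h: "h \<in> arr (x (\<phi> i)) y" "push (x (\<phi> i)) y h (b (\<phi> i)) = b (\<phi> j)"
        using div y_def by blast
      have "Suc (\<phi> i) \<le> \<phi> j" using \<phi> \<open>i < j\<close> by (simp add: strict_mono_def Suc_leI)
      then have "(x (\<phi> i), v (\<phi> i)) \<in> T (\<phi> j)" using T_mono T_Suc by blast
      then have "act V (x (\<phi> i)) y h (v (\<phi> i)) \<in> G"
        unfolding G_def cspan_def using h(1) arr_homs[OF x y] by (intro lin_span.base) blast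
      then show "\<exists>w\<in>G. lead y (b (\<phi> j)) (c (\<phi> i)) w"
        using lead_act[OF x y h(1) lead] h(2) by auto
    qed
  qed
  then obtain w where w: "w \<in> G" "lead y (b (\<phi> j)) (c (\<phi> j)) w" using j by auto
  let ?e = "c (\<phi> j) \<odot>\<^bsub>val V y\<^esub> e y (b (\<phi> j))"
  obtain u where u: "u \<in> lower y (b (\<phi> j))" "v (\<phi> j) = u \<oplus>\<^bsub>val V y\<^esub> ?e"
    using lead[of "\<phi> j"] unfolding lead_def y_def by blast
  obtain u' where u': "u' \<in> lower y (b (\<phi> j))" "w = u' \<oplus>\<^bsub>val V y\<^esub> ?e"
    using w(2) unfolding lead_def by blast
  note L = M.submoduleE[OF lower_submodule[OF y, of "b (\<phi> j)"]]
  define d where "d = u \<oplus>\<^bsub>val V y\<^esub> \<ominus>\<^bsub>val V y\<^esub> u'"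
  have d: "d \<in> lower y (b (\<phi> j))" unfolding d_def using L(3,5) u(1) u'(1) by blast
  have car: "u \<in> carrier (val V y)" "u' \<in> carrier (val V y)" "?e \<in> carrier (val V y)"
    using u(1) u'(1) L(1) M.smult_closed[OF bc(2) e_closed[OF y]] bc(1)[of "\<phi> j"] by (auto simp: y_def[symmetric])
  have vd: "v (\<phi> j) = d \<oplus>\<^bsub>val V y\<^esub> w"
    unfolding u(2) u'(2) d_def using car
    by (simp add: M.a_assoc M.r_neg2 M.r_neg1)
  \<comment> \<open>Two descriptions of the same \<open>d\<close>: by lower terms, and as a difference in \<open>H\<close>.\<close>
  have wd: "d = v (\<phi> j) \<oplus>\<^bsub>val V y\<^esub> \<ominus>\<^bsub>val V y\<^esub> w"
    unfolding vd using d L(1) u'(2) car by (auto simp: M.a_assoc M.r_neg)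
  have GH: "G \<subseteq> H y"
    unfolding G_def using cspan_minimal[OF H _ y] T by blast
  have "submodule (H y) R (val V y)" using H y by (simp add: csubmodule_def)
  note HE = M.submoduleE[OF this]
  have dH: "d \<in> H y" unfolding wd using HE(3,5) GH w(1) v y_def by blast
  have "d \<in> G"
  proof (cases "d = \<zero>\<^bsub>val V y\<^esub>")
    case True
    then show ?thesis by (simp add: G_def cspan_def lin_span.zero)
  next
    case False
    then obtain b' c' where "(b', b (\<phi> j)) \<in> less" "lead y b' c' d"
      using lead_exists[OF y _ d[unfolded lower_def]] by auto
    then show ?thesis using min[of "\<phi> j"] dH unfolding minimal_def G_def y_def by blast
  qed
  then have "v (\<phi> j) \<in> G" unfolding vd using M.submoduleE(5)[OF G] w(1) by blast
  then show False using new unfolding G_def y_def by blast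
qed

end

section \<open>Divisibility of injections by increasing maps\<close>

text \<open>A nonincreasing subsequence is constant from its minimum on.\<close>
lemma nat_seq_nondecreasing_subseq:
  fixes u :: "nat \<Rightarrow> nat"
  obtains \<phi> :: "nat \<Rightarrow> nat" where "strict_mono \<phi>" "\<And>i j. i \<le> j \<Longrightarrow> u (\<phi> i) \<le> u (\<phi> j)"
proof -
  obtain f :: "nat \<Rightarrow> nat" where f: "strict_mono f" "monoseq (\<lambda>n. u (f n))"
    using seq_monosub[of u] by blast
  then consider "\<forall>m. \<forall>n\<ge>m. u (f m) \<le> u (f n)" | "\<forall>m. \<forall>n\<ge>m. u (f n) \<le> u (f m)"
    unfolding monoseq_def by blast
  then show ?thesis
  proof cases
    case 1
    then show ?thesis using that f by blast
  next
    case 2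
    define k where "k = (ARG_MIN (\<lambda>n. u (f n)) n. True)"
    have k: "u (f k) \<le> u (f n)" for n
      unfolding k_def by (rule arg_min_nat_le) simp
    have "strict_mono (\<lambda>n. f (n + k))" using f(1) by (simp add: strict_mono_def)
    moreover have "u (f (i + k)) \<le> u (f (j + k))" for i j
      using 2 k[of "j + k"] by (meson le_add2 le_trans)
    ultimately show ?thesis using that by blast
  qed
qed

lemma dickson:
  fixes u :: "nat \<Rightarrow> 'i \<Rightarrow> nat"
  assumes "finite A"
  obtains \<phi> :: "nat \<Rightarrow> nat" where "strict_mono \<phi>" "\<And>i j a. \<lbrakk>i \<le> j; a \<in> A\<rbrakk> \<Longrightarrow> u (\<phi> i) a \<le> u (\<phi> j) a"
proof -
  have "\<exists>\<phi>::nat \<Rightarrow> nat. strict_mono \<phi> \<and> (\<forall>i j. \<forall>a\<in>A. i \<le> j \<longrightarrow> u (\<phi> i) a \<le> u (\<phi> j) a)"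
    using assms
  proof induction
    case empty
    then show ?case using strict_mono_id by auto
  next
    case (insert b A)
    then obtain \<phi> :: "nat \<Rightarrow> nat" where \<phi>: "strict_mono \<phi>"
      "\<And>i j a. \<lbrakk>a \<in> A; i \<le> j\<rbrakk> \<Longrightarrow> u (\<phi> i) a \<le> u (\<phi> j) a" by blast
    obtain \<psi> :: "nat \<Rightarrow> nat" where \<psi>: "strict_mono \<psi>"
      "\<And>i j. i \<le> j \<Longrightarrow> u (\<phi> (\<psi> i)) b \<le> u (\<phi> (\<psi> j)) b"
      using nat_seq_nondecreasing_subseq[of "\<lambda>n. u (\<phi> n) b"] by blast
    have "strict_mono (\<phi> \<circ> \<psi>)" using \<phi>(1) \<psi>(1) by (rule strict_mono_o)
    moreover have "u ((\<phi> \<circ> \<psi>) i) a \<le> u ((\<phi> \<circ> \<psi>) j) a" if "a \<in> insert b A" "i \<le> j" for i j a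
      using that \<phi>(2)[of a "\<psi> i" "\<psi> j"] \<psi> by (auto simp: strict_mono_less_eq)
    ultimately show ?case by blast
  qed
  then show ?thesis using that by blast
qed

text \<open>An injection \<open>f : [n] \<rightarrow> [t]\<close> extended by the end points \<open>0 \<mapsto> 0\<close> and \<open>n + 1 \<mapsto> t + 1\<close>, so
  that the stretches before the first and after the last value count as gaps too.\<close>

definition bracket :: "nat \<Rightarrow> nat \<Rightarrow> (nat \<Rightarrow> nat) \<Rightarrow> nat \<Rightarrow> nat" where
  "bracket n t f a = (if a = 0 then 0 else if a \<le> n then f a else Suc t)"

lemma bracket_inj:
  assumes "f \<in> {1..n} \<rightarrow> {1..t}" "inj_on f {1..n}"
  shows "inj_on (bracket n t f) {0..Suc n}"
proof (rule inj_onI)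
  have range: "1 \<le> f a \<and> f a \<le> t" if "a \<noteq> 0" "a \<le> n" for a
    using assms(1) that by (auto simp: Pi_iff)
  fix a b assume "a \<in> {0..Suc n}" "b \<in> {0..Suc n}" "bracket n t f a = bracket n t f b"
  then show "a = b"
    using range[of a] range[of b] inj_onD[OF assms(2), of a b]
    by (auto simp: bracket_def split: if_splits)
qed

text \<open>The combinatorial heart: divisibility of injections by increasing maps is controlled by finitely
  many natural numbers. If each truncated difference between values of \<open>f\<close> is at most the
  corresponding difference for \<open>g\<close>, then \<open>g = h f\<close> for an increasing \<open>h\<close>. Truncation makes the
  condition also say that \<open>g\<close> orders its values as \<open>f\<close> does: a positive difference for \<open>f\<close> forces
  a positive one for \<open>g\<close>. The map \<open>h\<close> runs with slope one from each value of \<open>f\<close> to the next;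
  taking a maximum over all earlier values of \<open>f\<close> avoids naming the nearest one.\<close>
lemma increasing_extension:
  assumes f: "f \<in> {1..n} \<rightarrow> {1..t}" "inj_on f {1..n}"
    and gaps: "\<And>a b. \<lbrakk>a \<le> Suc n; b \<le> Suc n\<rbrakk> \<Longrightarrow>
      bracket n t f b - bracket n t f a \<le> bracket n t' g b - bracket n t' g a"
  obtains h where "h \<in> {1..t} \<rightarrow>\<^sub>E {1..t'}" "strict_mono_on {1..t} h"
    "\<And>a. a \<in> {1..n} \<Longrightarrow> h (f a) = g a"
proof -
  let ?f = "bracket n t f" and ?g = "bracket n t' g"
  define X where "X s = (\<lambda>a. ?g a + (s - ?f a)) ` {a. a \<le> Suc n \<and> ?f a \<le> s}" for s
  define h where "h s = Max (X s)" for s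
  have fin: "finite (X s)" for s unfolding X_def by simp
  have ne: "X s \<noteq> {}" for s unfolding X_def by (auto simp: bracket_def intro!: exI[of _ 0])
  have hit: "h (?f b) = ?g b" if b: "b \<le> Suc n" for b
    unfolding h_def
  proof (rule Max_eqI[OF fin])
    show "?g b \<in> X (?f b)" unfolding X_def using b by force
    fix z assume "z \<in> X (?f b)"
    then obtain a where a: "a \<le> Suc n" "?f a \<le> ?f b" "z = ?g a + (?f b - ?f a)"
      unfolding X_def by blast
    show "z \<le> ?g b"
    proof (cases "?f a = ?f b")
      case True
      then have "a = b" using inj_onD[OF bracket_inj[OF f]] a b by simp
      then show ?thesis using a by simp
    next
      case False
      then show ?thesis using gaps[OF a(1) b] a by linarith
    qed
  qed
  have mono: "h s < h s'" if "s < s'" for s s'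
  proof -
    obtain a where a: "a \<le> Suc n" "?f a \<le> s" "h s = ?g a + (s - ?f a)"
      using Max_in[OF fin ne, of s] unfolding h_def X_def by blast
    have "?g a + (s' - ?f a) \<in> X s'" unfolding X_def using a that by auto
    then have "?g a + (s' - ?f a) \<le> h s'" unfolding h_def using fin by (intro Max_ge)
    then show ?thesis using a that by linarith
  qed
  \<comment> \<open>The end points confine the strictly increasing \<open>h\<close> to \<open>{1..t'}\<close>.\<close>
  have "h s \<in> {1..t'}" if "s \<in> {1..t}" for s
  proof -
    have "h 0 = 0" "h (Suc t) = Suc t'"
      using hit[of 0] hit[of "Suc n"] by (simp_all add: bracket_def)
    then show ?thesis using mono[of 0 s] mono[of s "Suc t"] that by simp
  qed
  then have "restrict h {1..t} \<in> {1..t} \<rightarrow>\<^sub>E {1..t'}" by simp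
  moreover have "strict_mono_on {1..t} (restrict h {1..t})"
    using mono by (simp add: strict_mono_on_def)
  moreover have "restrict h {1..t} (f a) = g a" if "a \<in> {1..n}" for a
    using hit[of a] that f(1) by (auto simp: bracket_def Pi_iff)
  ultimately show ?thesis using that by blast
qed

lemma FI_pow_simps:
  "obs (FI_pow m) = {1..m} \<rightarrow>\<^sub>E UNIV"
  "f \<in> homs (FI_pow m) n t \<longleftrightarrow>
    f \<in> extensional {1..m} \<and> (\<forall>i\<in>{1..m}. f i \<in> {1..n i} \<rightarrow>\<^sub>E {1..t i} \<and> inj_on (f i) {1..n i})"
  "cmp (FI_pow m) n t u g f = (\<lambda>i\<in>{1..m}. \<lambda>a\<in>{1..n i}. g i (f i a))"
  by (auto simp: FI_pow_def PiE_iff compose_def)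

lemma finite_homs_FI_pow: "finite (homs (FI_pow m) n t)"
  by (auto simp: FI_pow_def intro!: finite_PiE)

definition increasing_homs :: "nat \<Rightarrow> (nat \<Rightarrow> nat) \<Rightarrow> (nat \<Rightarrow> nat) \<Rightarrow> (nat \<Rightarrow> nat \<Rightarrow> nat) set" where
  "increasing_homs m n t = {h \<in> homs (FI_pow m) n t. \<forall>i\<in>{1..m}. strict_mono_on {1..n i} (h i)}"

text \<open>For a fixed source, the differences of all components form one vector of natural numbers of
  fixed length, so Dickson's lemma applies.\<close>
lemma FI_pow_divisible_subseq:
  fixes x :: "nat \<Rightarrow> nat \<Rightarrow> nat" and f :: "nat \<Rightarrow> nat \<Rightarrow> nat \<Rightarrow> nat"
  assumes f: "\<And>k. f k \<in> homs (FI_pow m) n (x k)"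
  shows "\<exists>\<phi>::nat \<Rightarrow> nat. strict_mono \<phi> \<and> (\<forall>k l. k < l \<longrightarrow>
    (\<exists>h\<in>increasing_homs m (x (\<phi> k)) (x (\<phi> l)).
       cmp (FI_pow m) n (x (\<phi> k)) (x (\<phi> l)) h (f (\<phi> k)) = f (\<phi> l)))"
proof -
  define A where "A = (SIGMA i:{1..m}. {0..Suc (n i)} \<times> {0..Suc (n i)})"
  define br where "br k i = bracket (n i) (x k i) (f k i)" for k i
  define u where "u k = (\<lambda>(i, a, b). br k i b - br k i a)" for k
  have "finite A" unfolding A_def by (intro finite_SigmaI finite_cartesian_product) simp_all
  then obtain \<phi> :: "nat \<Rightarrow> nat" where \<phi>: "strict_mono \<phi>"
    and le: "\<And>k l p. \<lbrakk>k \<le> l; p \<in> A\<rbrakk> \<Longrightarrow> u (\<phi> k) p \<le> u (\<phi> l) p"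
    using dickson[of A u] by blast
  have "\<exists>h\<in>increasing_homs m (x (\<phi> k)) (x (\<phi> l)).
       cmp (FI_pow m) n (x (\<phi> k)) (x (\<phi> l)) h (f (\<phi> k)) = f (\<phi> l)" if "k < l" for k l
  proof -
    have fe: "f k i \<in> {1..n i} \<rightarrow>\<^sub>E {1..x k i}" "inj_on (f k i) {1..n i}" if "i \<in> {1..m}" for k i
      using f[of k] that by (auto simp: FI_pow_simps)
    have "\<exists>h. h \<in> {1..x (\<phi> k) i} \<rightarrow>\<^sub>E {1..x (\<phi> l) i} \<and> strict_mono_on {1..x (\<phi> k) i} h \<and>
        (\<forall>a\<in>{1..n i}. h (f (\<phi> k) i a) = f (\<phi> l) i a)" (is "\<exists>h. ?P i h") if i: "i \<in> {1..m}" for i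
    proof (rule increasing_extension)
      show "f (\<phi> k) i \<in> {1..n i} \<rightarrow> {1..x (\<phi> k) i}" using fe(1)[OF i] by (simp add: PiE_iff Pi_iff)
      show "inj_on (f (\<phi> k) i) {1..n i}" by (rule fe(2)[OF i])
      show "bracket (n i) (x (\<phi> k) i) (f (\<phi> k) i) b - bracket (n i) (x (\<phi> k) i) (f (\<phi> k) i) a
          \<le> bracket (n i) (x (\<phi> l) i) (f (\<phi> l) i) b - bracket (n i) (x (\<phi> l) i) (f (\<phi> l) i) a"
        if "a \<le> Suc (n i)" "b \<le> Suc (n i)" for a b
        using le[of k l "(i, a, b)"] \<open>k < l\<close> i that by (simp add: u_def br_def A_def)
    qed blast
    then have "\<forall>i\<in>{1..m}. \<exists>h. ?P i h" by blast
    from bchoice[OF this] obtain h where h: "\<And>i. i \<in> {1..m} \<Longrightarrow> ?P i (h i)" by blast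
    have "inj_on (h i) {1..x (\<phi> k) i}" if "i \<in> {1..m}" for i
      using h[OF that] strict_mono_on_imp_inj_on by blast
    then have "restrict h {1..m} \<in> increasing_homs m (x (\<phi> k)) (x (\<phi> l))"
      unfolding increasing_homs_def mem_Collect_eq FI_pow_simps
      using h by auto
    moreover have "cmp (FI_pow m) n (x (\<phi> k)) (x (\<phi> l)) (restrict h {1..m}) (f (\<phi> k)) = f (\<phi> l)"
      (is "?c = _")
    proof (rule extensionalityI[of _ "{1..m}"])
      show "?c \<in> extensional {1..m}" "f (\<phi> l) \<in> extensional {1..m}"
        using f[of "\<phi> l"] by (auto simp: FI_pow_simps)
      fix i assume i: "i \<in> {1..m}"
      show "?c i = f (\<phi> l) i"
      proof (rule extensionalityI[of _ "{1..n i}"])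
        show "?c i \<in> extensional {1..n i}" "f (\<phi> l) i \<in> extensional {1..n i}"
          using i fe(1)[OF i] by (auto simp: FI_pow_simps PiE_iff)
        show "?c i a = f (\<phi> l) i a" if "a \<in> {1..n i}" for a
          using h[OF i] i that by (simp add: FI_pow_simps)
      qed
    qed
    ultimately show ?thesis by blast
  qed
  with \<phi> show ?thesis by blast
qed

section \<open>The monomial order on tuples of injections\<close>

lemma map_lenlex_mono:
  assumes "(map F ps, map G ps) \<in> lenlex less_than"
    and "\<And>p. p \<in> set ps \<Longrightarrow> F p < G p \<Longrightarrow> F' p < (G' p :: nat)"
    and "\<And>p. p \<in> set ps \<Longrightarrow> F p = G p \<Longrightarrow> F' p = G' p"
  shows "(map F' ps, map G' ps) \<in> lenlex less_than"
  using assms by (induction ps) (auto simp: Cons_lenlex_iff)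

definition positions :: "nat \<Rightarrow> (nat \<Rightarrow> nat) \<Rightarrow> (nat \<times> nat) list" where
  "positions m n = concat (map (\<lambda>i. map (Pair i) [1..<Suc (n i)]) [1..<Suc m])"

lemma set_positions: "set (positions m n) = (SIGMA i:{1..m}. {1..n i})"
  unfolding positions_def by (fastforce simp: image_iff simp del: upt_Suc)

text \<open>A tuple of injections read as the list of its values, in a fixed order of the arguments.
  Comparing these lists lexicographically orders the arrows.\<close>
definition entries :: "nat \<Rightarrow> (nat \<Rightarrow> nat) \<Rightarrow> (nat \<Rightarrow> nat \<Rightarrow> nat) \<Rightarrow> nat list" where
  "entries m n f = map (\<lambda>(i, a). f i a) (positions m n)"

lemma entries_inj:
  assumes "f \<in> homs (FI_pow m) n t" "g \<in> homs (FI_pow m) n t" "entries m n f = entries m n g"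
  shows "f = g"
proof (rule extensionalityI[of _ "{1..m}"])
  show "f \<in> extensional {1..m}" "g \<in> extensional {1..m}"
    using assms by (auto simp: FI_pow_simps)
  fix i assume i: "i \<in> {1..m}"
  show "f i = g i"
  proof (rule extensionalityI[of _ "{1..n i}"])
    show "f i \<in> extensional {1..n i}" "g i \<in> extensional {1..n i}"
      using assms i by (auto simp: FI_pow_simps PiE_iff)
    show "f i a = g i a" if "a \<in> {1..n i}" for a
      using assms(3) i that by (auto simp: entries_def set_positions)
  qed
qed

text \<open>An increasing map preserves equality and strict inequality of entries, hence the first
  position at which two lists differ and the direction of the difference there.\<close>
lemma entries_increasing:
  assumes f: "f \<in> homs (FI_pow m) n t" and g: "g \<in> homs (FI_pow m) n t"
    and h: "h \<in> increasing_homs m t t'"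
    and less: "(entries m n f, entries m n g) \<in> lenlex less_than"
  shows "(entries m n (cmp (FI_pow m) n t t' h f), entries m n (cmp (FI_pow m) n t t' h g)) \<in> lenlex less_than"
  unfolding entries_def
proof (rule map_lenlex_mono)
  show "(map (\<lambda>(i, a). f i a) (positions m n), map (\<lambda>(i, a). g i a) (positions m n)) \<in> lenlex less_than"
    using less by (simp add: entries_def)
  fix p assume "p \<in> set (positions m n)"
  then obtain i a where p: "p = (i, a)" "i \<in> {1..m}" "a \<in> {1..n i}"
    by (auto simp: set_positions)
  have "f i a \<in> {1..t i}" "g i a \<in> {1..t i}" "strict_mono_on {1..t i} (h i)"
    using f g h p by (auto simp: FI_pow_simps increasing_homs_def PiE_iff)
  then show "(case p of (i, a) \<Rightarrow> cmp (FI_pow m) n t t' h f i a)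
      < (case p of (i, a) \<Rightarrow> cmp (FI_pow m) n t t' h g i a)"
    if "(case p of (i, a) \<Rightarrow> f i a) < (case p of (i, a) \<Rightarrow> g i a)"
    using that p by (simp add: FI_pow_simps strict_mono_on_def)
  show "(case p of (i, a) \<Rightarrow> cmp (FI_pow m) n t t' h f i a)
      = (case p of (i, a) \<Rightarrow> cmp (FI_pow m) n t t' h g i a)"
    if "(case p of (i, a) \<Rightarrow> f i a) = (case p of (i, a) \<Rightarrow> g i a)"
    using that p by (simp add: FI_pow_simps)
qed

text \<open>The monomials of a module spanned by a finite list of generators are the translates of the
  generators, one for each index and arrow. They are ordered by length of the list, then by index,
  then by entries; since arrows leave the index and the length alone, only the entries matter for
  compatibility.\<close>
lemma FI_pow_monomial_cmodule:
  fixes gens :: "((nat \<Rightarrow> nat) \<times> 'v) list" and m :: nat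
  defines "n \<equiv> \<lambda>i. fst (gens ! i)"
  assumes V: "cmodule R (FI_pow m) V"
    and gens: "set gens \<subseteq> Sigma (obs (FI_pow m)) (\<lambda>x. carrier (val V x))"
    and span: "\<And>x. x \<in> obs (FI_pow m) \<Longrightarrow> carrier (val V x) = cspan R (FI_pow m) V (set gens) x"
  shows "monomial_cmodule R (FI_pow m) V
    (\<lambda>x. SIGMA i:{..<length gens}. homs (FI_pow m) (n i) x)
    (\<lambda>x (i, f). act V (n i) x f (snd (gens ! i)))
    (inv_image (lenlex less_than) (\<lambda>(i, f). i # entries m (n i) f))
    (increasing_homs m)
    (\<lambda>x y h (i, f). (i, cmp (FI_pow m) (n i) x y h f))"
    (is "monomial_cmodule _ _ _ ?B ?e ?less ?arr ?push")
proof -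
  interpret category "FI_pow m" by (rule category_FI_pow)
  interpret V: cmodule R "FI_pow m" V by fact
  have gen: "n i \<in> obs (FI_pow m)" "snd (gens ! i) \<in> carrier (val V (n i))" if "i < length gens" for i
    using subsetD[OF gens nth_mem[OF that]] unfolding n_def by (auto simp: mem_Sigma_iff split_beta)
  have arr: "h \<in> homs (FI_pow m) x y" if "h \<in> increasing_homs m x y" for h x y
    using that by (simp add: increasing_homs_def)
  show ?thesis
  proof (intro monomial_cmodule.intro monomial_cmodule_axioms.intro category_FI_pow V)
    show "wf ?less" by (intro wf_inv_image wf_lenlex wf_less_than)
    show "trans ?less" by (intro trans_inv_image lenlex_transI trans_less_than)
    show "total_on (?B x) ?less" for x
    proof (rule total_onI)
      fix p q assume p: "p \<in> ?B x" and q: "q \<in> ?B x" and "p \<noteq> q"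
      moreover obtain i f j g where pq: "p = (i, f)" "q = (j, g)" by fastforce
      ultimately have "i # entries m (n i) f \<noteq> j # entries m (n j) g"
        using entries_inj by auto
      moreover have "total (lenlex (less_than))" by (intro total_lenlex) (auto simp: total_on_def)
      ultimately show "(p, q) \<in> ?less \<or> (q, p) \<in> ?less"
        using pq by (auto simp: total_on_def)
    qed
    show "?e x b \<in> carrier (val V x)" if "x \<in> obs (FI_pow m)" "b \<in> ?B x" for x b
      using that gen V.act_closed by auto
    show "carrier (val V x) \<subseteq> lin_span R (val V x) (?e x ` ?B x)" if "x \<in> obs (FI_pow m)" for x
      unfolding span[OF that] cspan_def
    proof (rule lin_span_mono, clarify)
      fix y f v assume yv: "(y, v) \<in> set gens" and f: "f \<in> homs (FI_pow m) y x"
      then obtain i where "i < length gens" "gens ! i = (y, v)" by (auto simp: in_set_conv_nth)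
      then show "act V y x f v \<in> ?e x ` ?B x"
        using f by (intro image_eqI[of _ _ "(i, f)"]) (auto simp: n_def)
    qed
    show "increasing_homs m x y \<subseteq> homs (FI_pow m) x y" for x y using arr by blast
    show "?push x y h b \<in> ?B y"
      if "x \<in> obs (FI_pow m)" "y \<in> obs (FI_pow m)" "h \<in> increasing_homs m x y" "b \<in> ?B x" for x y h b
      using that gen cmp_closed arr by auto
    show "act V x y h (?e x b) = ?e y (?push x y h b)"
      if "x \<in> obs (FI_pow m)" "y \<in> obs (FI_pow m)" "h \<in> increasing_homs m x y" "b \<in> ?B x" for x y h b
      using that gen V.act_cmp arr by auto
    show "(?push x y h b, ?push x y h c) \<in> ?less"
      if "x \<in> obs (FI_pow m)" "y \<in> obs (FI_pow m)" "h \<in> increasing_homs m x y" "b \<in> ?B x" "c \<in> ?B x"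
        "(b, c) \<in> ?less" for x y h b c
    proof -
      obtain i f j g where bc: "b = (i, f)" "c = (j, g)" by fastforce
      have "(entries m (n i) (cmp (FI_pow m) (n i) x y h f), entries m (n i) (cmp (FI_pow m) (n i) x y h g))
          \<in> lenlex less_than" if "i = j" "(entries m (n i) f, entries m (n i) g) \<in> lenlex less_than"
        using that \<open>b \<in> ?B x\<close> \<open>c \<in> ?B x\<close> bc entries_increasing \<open>h \<in> increasing_homs m x y\<close> by auto
      then show ?thesis
        using \<open>(b, c) \<in> ?less\<close> bc by (auto simp: Cons_lenlex_iff) (auto simp: entries_def)
    qed
    show "\<exists>\<phi>::nat \<Rightarrow> nat. strict_mono \<phi> \<and> (\<forall>k l. k < l \<longrightarrow>
        (\<exists>h\<in>increasing_homs m (x (\<phi> k)) (x (\<phi> l)). ?push (x (\<phi> k)) (x (\<phi> l)) h (b (\<phi> k)) = b (\<phi> l)))"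
      if xb: "\<And>k::nat. x k \<in> obs (FI_pow m) \<and> b k \<in> ?B (x k)" for x b
    proof -
      \<comment> \<open>First fix the generator by the pigeonhole principle, then apply Dickson's lemma.\<close>
      have fst: "fst (b k) < length gens" "snd (b k) \<in> homs (FI_pow m) (n (fst (b k))) (x k)" for k
        using xb[of k] by auto
      then have "finite (range (\<lambda>k. fst (b k)))"
        by (intro finite_subset[OF _ finite_lessThan[of "length gens"]]) auto
      then obtain k0 where k0: "infinite {k. fst (b k) = fst (b k0)}"
        using pigeonhole_infinite[of UNIV "\<lambda>k. fst (b k)"] by auto
      define i where "i = fst (b k0)"
      obtain r :: "nat \<Rightarrow> nat" where r: "strict_mono r" "\<And>k. fst (b (r k)) = i"
        using infinite_enumerate[OF k0] i_def by auto
      have fk: "snd (b (r k)) \<in> homs (FI_pow m) (n i) (x (r k))" for k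
        using fst(2)[of "r k"] r(2)[of k] by simp
      from FI_pow_divisible_subseq[where f = "\<lambda>k. snd (b (r k))" and x = "\<lambda>k. x (r k)", OF fk]
      obtain \<phi> :: "nat \<Rightarrow> nat" where \<phi>: "strict_mono \<phi>"
        "\<forall>k l. k < l \<longrightarrow> (\<exists>h\<in>increasing_homs m (x (r (\<phi> k))) (x (r (\<phi> l))).
          cmp (FI_pow m) (n i) (x (r (\<phi> k))) (x (r (\<phi> l))) h (snd (b (r (\<phi> k)))) = snd (b (r (\<phi> l))))"
        by (elim exE conjE)
      have "strict_mono (r \<circ> \<phi>)" using r(1) \<phi>(1) by (rule strict_mono_o)
      moreover have "\<exists>h\<in>increasing_homs m (x ((r \<circ> \<phi>) k)) (x ((r \<circ> \<phi>) l)).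
          ?push (x ((r \<circ> \<phi>) k)) (x ((r \<circ> \<phi>) l)) h (b ((r \<circ> \<phi>) k)) = b ((r \<circ> \<phi>) l)" if "k < l" for k l
        using \<phi>(2) that r(2) by (simp add: split_beta prod_eq_iff)
      ultimately show ?thesis by blast
    qed
  qed
qed

section \<open>Local Noetherianity\<close>

theorem theorem1p1:
  fixes R :: "('r, 'x) ring_scheme" and m :: nat
  assumes "cring R" and "noetherian_ring R" and "m \<ge> 1"
  shows "locally_noetherian TYPE('v) R (FI_pow m)"
  unfolding locally_noetherian_def
proof (intro allI impI, elim conjE)
  fix V :: "(nat \<Rightarrow> nat, nat \<Rightarrow> nat \<Rightarrow> nat, 'r, 'v) cmod" and H
  assume V: "cmodule R (FI_pow m) V" and fg: "finitely_generated R (FI_pow m) V"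
    and H: "csubmodule H R (FI_pow m) V"
  obtain S where S: "finite S" "S \<subseteq> Sigma (obs (FI_pow m)) (\<lambda>x. carrier (val V x))"
    "\<And>x. x \<in> obs (FI_pow m) \<Longrightarrow> carrier (val V x) = cspan R (FI_pow m) V S x"
    using finitely_generated_imp_cspan[OF category_FI_pow assms(1) V finite_homs_FI_pow fg] by blast
  obtain gens where gens: "set gens = S" using finite_list[OF S(1)] by blast
  note monomials = FI_pow_monomial_cmodule[OF V, of gens, unfolded gens, OF S(2,3)]
  obtain T where "finite T" "T \<subseteq> Sigma (obs (FI_pow m)) H"
    "\<And>x. x \<in> obs (FI_pow m) \<Longrightarrow> H x = cspan R (FI_pow m) V T x"
    using monomial_cmodule.csubmodule_finitely_spanned[OF monomials assms(2) H] by blast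
  then show "finitely_generated R (FI_pow m) (sub_cmod V H)"
    by (rule cspan_imp_finitely_generated[OF category_FI_pow assms(1) V finite_homs_FI_pow H])
qed

end
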